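(* Let $OE(n)$ be the number of odd-even partitions of $n$ for $n\ge1$, $OE(0):=1$, and set $\mathscr{O}_e(q)=\sum_{n\ge0}OE(2n)q^{2n}$ and $\mathscr{O}_o(q)=\sum_{n\ge0}OE(2n+1)q^{2n+1}$. Then \[ \mathscr{O}_e(e^{-\varepsilon})\sim \mathscr{O}_o(e^{-\varepsilon})\sim \frac{1}{\sqrt{2\sqrt{5}}}\,e^{\frac{\pi^2}{20\varepsilon}} \] as $\varepsilon\to0^+$.
   Context: An odd-even partition of $n$ is a partition of $n$ (nonincreasing sequence of positive integers summing to $n$) in which the parts alternate in parity, starting with the smallest part odd. One has $\sum_{n\ge0}OE(n)q^n=\sum_{m\ge0}\frac{q^{m(m+1)/2}}{(q^2;q^2)_m}$, with $(a;q)_m=\prod_{j=1}^m(1-aq^{j-1})$; $\mathscr{O}_e$ and $\mathscr{O}_o$ consist of the terms with $m\equiv0,3\pmod 4$ and $m\equiv1,2\pmod4$ respectively. *)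

theory Defs
  imports Complex_Main "HOL-Library.Landau_Symbols"
begin

text \<open>A partition is the nonincreasing list of its parts, so \<^term>\<open>last xs\<close> is the smallest part.\<close>

definition partition_of :: "nat \<Rightarrow> nat list \<Rightarrow> bool" where
  "partition_of n xs \<longleftrightarrow> sorted_wrt (\<ge>) xs \<and> (\<forall>x\<in>set xs. 0 < x) \<and> sum_list xs = n"

definition odd_even_partition_of :: "nat \<Rightarrow> nat list \<Rightarrow> bool" where
  "odd_even_partition_of n xs \<longleftrightarrow>
     partition_of n xs \<and> successively (\<lambda>x y. even x \<noteq> even y) xs \<and> (xs \<noteq> [] \<longrightarrow> odd (last xs))"

definition OE :: "nat \<Rightarrow> nat" where
  "OE n = (if n = 0 then 1 else card {xs. odd_even_partition_of n xs})"

definition OE_even_gf :: "real \<Rightarrow> real" where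
  "OE_even_gf q = (\<Sum>n. real (OE (2 * n)) * q ^ (2 * n))"

definition OE_odd_gf :: "real \<Rightarrow> real" where
  "OE_odd_gf q = (\<Sum>n. real (OE (2 * n + 1)) * q ^ (2 * n + 1))"

end

theory Submission
  imports Defs "HOL-Analysis.Analysis" "HOL-Real_Asymp.Real_Asymp"
begin

text \<open>
  Put \<open>q = exp (- \<epsilon>)\<close> and let \<open>a\<^sub>m\<close> be the \<open>m\<close>-th term of the given series, so that
  \<open>a\<^sub>m = (\<Prod>j=1..m. 1 / (2 * sinh (j * \<epsilon>)))\<close>. The even and odd parts are half the sum and half the
  difference of the values of the series \<open>F\<close> at \<open>q\<close> and at \<open>- q\<close>.

  The series at \<open>- q\<close> carries the signs \<open>+, -, -, +\<close> with period 4, so it is bounded by the total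
  variation of \<open>a\<close>. By the arithmetic-geometric mean inequality this is controlled by
  \<open>\<Sum>m. a\<^sub>m * (1 - 2 * sinh (m * \<epsilon>))\<^sup>2\<close>, which the recurrence of \<open>a\<close> sums to \<open>O(\<epsilon>) * F(q)\<close>.
  Hence the series at \<open>- q\<close> is negligible.

  For the series at \<open>q\<close>, the values \<open>G\<^sub>n = (\<Sum>m. a\<^sub>m * q\<^bsup>nm\<^esup>)\<close> satisfy
  \<open>G\<^sub>n = G\<^sub>n\<^sub>+\<^sub>2 + q\<^bsup>n+1\<^esup> * G\<^sub>n\<^sub>+\<^sub>1\<close> and tend to 1. The coefficients are positive, so sub- and
  supersolutions can be compared. A WKB ansatz with \<open>x = n * \<epsilon>\<close> and \<open>2 * sinh \<sigma>(x) = exp (- x)\<close> gives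
  the approximate solution \<open>cosh (\<sigma>(x)) powr (- 1/2) * exp (S(x) / \<epsilon>)\<close> with \<open>S' = - \<sigma>\<close>, whose
  relative residual \<open>O(\<epsilon>\<^sup>2 * q\<^sup>n)\<close> sums to \<open>O(\<epsilon>)\<close>. Finally \<open>S(0) = \<pi>\<^sup>2 / 20\<close> is a
  dilogarithm value at the golden ratio.
\<close>

section \<open>Odd-even partitions counted by number of parts, and the series of
  \<open>OE\<close>\<close>

section \<open>The generating function\<close>

text \<open>Equals \<open>q^(m(m+1)/2) / (q^2; q^2)_m\<close>; the power of \<open>q\<close> is
  spread over the factors, so that consecutive terms differ by a single factor.\<close>

definition oe_term :: "real \<Rightarrow> nat \<Rightarrow> real" where
  "oe_term q m = (\<Prod>j=1..m. q ^ j / (1 - q ^ (2 * j)))"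

definition oe_lists :: "nat \<Rightarrow> nat list set" where
  "oe_lists m = {xs. odd_even_partition_of (sum_list xs) xs \<and> length xs = m}"

text \<open>An odd shift flips every parity: alternation survives, and the formerly odd last part
  becomes even, so an odd part may follow it.\<close>

lemma oe_lists_append:
  assumes "xs \<in> oe_lists m"
  shows "map (\<lambda>x. x + (2 * k + 1)) xs @ [2 * k + 1] \<in> oe_lists (Suc m)"
  using assms
  by (cases "xs = []")
     (auto simp: oe_lists_def odd_even_partition_of_def partition_of_def sorted_wrt_append
      sorted_wrt_map successively_append_iff successively_map last_map)

text \<open>Removing the smallest part and subtracting it from all others inverts the shift.\<close>

lemma oe_lists_split:
  assumes "zs \<in> oe_lists (Suc m)"
  obtains k xs where "xs \<in> oe_lists m" "zs = map (\<lambda>x. x + (2 * k + 1)) xs @ [2 * k + 1]"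
proof -
  from assms obtain xs y where zs: "zs = xs @ [y]" and len: "length xs = m"
    unfolding oe_lists_def by (auto simp: length_Suc_conv_rev)
  from assms have sorted: "sorted_wrt (\<ge>) xs" and ge: "\<And>x. x \<in> set xs \<Longrightarrow> y \<le> x"
    and alt: "successively (\<lambda>x y. even x \<noteq> even y) xs" and "odd y"
    and last: "xs \<noteq> [] \<Longrightarrow> even (last xs) \<noteq> even y"
    unfolding oe_lists_def odd_even_partition_of_def partition_of_def zs
    by (auto simp: sorted_wrt_append successively_append_iff)
  from \<open>odd y\<close> obtain k where k: "y = 2 * k + 1" by (auto elim: oddE)
  define ys where "ys = map (\<lambda>x. x - y) xs"
  have restore: "map (\<lambda>x. x + y) ys = xs"
    unfolding ys_def by (simp add: map_idI ge)
  \<comment> \<open>Opposite parity makes \<open>last xs\<close> strictly larger than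
    \<open>y\<close>, so the subtraction leaves positive parts.\<close>
  have pos: "y < x" if "x \<in> set xs" for x
  proof -
    have "xs \<noteq> []" using that by auto
    then have "last xs \<noteq> y" using last by auto
    then have "y < last xs" using ge[of "last xs"] \<open>xs \<noteq> []\<close> by (simp add: order_less_le)
    moreover have "last xs \<le> x"
    proof -
      have "xs = butlast xs @ [last xs]" using \<open>xs \<noteq> []\<close> by simp
      with sorted that show ?thesis
        by (metis (mono_tags, lifting) Un_iff empty_iff empty_set order_refl set_ConsD set_append
            sorted_wrt_append list.set_intros(1))
    qed
    ultimately show ?thesis by simp
  qed
  have even: "even (x - y) \<longleftrightarrow> odd x" if "x \<in> set xs" for x
    using ge[OF that] \<open>odd y\<close> by auto
  have "successively (\<lambda>x y. even x \<noteq> even y) ys"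
    unfolding ys_def successively_map
    using alt by (rule successively_mono) (auto simp: even dest!: pos)
  moreover have "sorted_wrt (\<ge>) ys"
    unfolding ys_def sorted_wrt_map
    by (rule sorted_wrt_mono_rel[OF _ sorted]) auto
  moreover have "ys \<noteq> [] \<longrightarrow> odd (last ys)"
    using last \<open>odd y\<close> pos[of "last xs"] by (auto simp: ys_def last_map even)
  ultimately have "ys \<in> oe_lists m"
    using pos len by (auto simp: oe_lists_def odd_even_partition_of_def partition_of_def ys_def)
  moreover have "zs = map (\<lambda>x. x + (2 * k + 1)) ys @ [2 * k + 1]"
    using restore by (simp add: zs k)
  ultimately show ?thesis by (rule that)
qed

lemma bij_betw_oe_lists:
  "bij_betw (\<lambda>(k, xs). map (\<lambda>x. x + (2 * k + 1)) xs @ [2 * k + 1])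
     (UNIV \<times> oe_lists m) (oe_lists (Suc m))"
proof (rule bij_betw_imageI)
  show "inj_on (\<lambda>(k, xs). map (\<lambda>x. x + (2 * k + 1)) xs @ [2 * k + 1]) (UNIV \<times> oe_lists m)"
    by (auto simp: inj_on_def dest!: map_injective)
  show "(\<lambda>(k, xs). map (\<lambda>x. x + (2 * k + 1)) xs @ [2 * k + 1]) ` (UNIV \<times> oe_lists m)
      = oe_lists (Suc m)"
  proof (intro equalityI subsetI)
    fix zs assume "zs \<in> oe_lists (Suc m)"
    then obtain k xs where "xs \<in> oe_lists m" "zs = map (\<lambda>x. x + (2 * k + 1)) xs @ [2 * k + 1]"
      by (rule oe_lists_split)
    then show "zs \<in> (\<lambda>(k, xs). map (\<lambda>x. x + (2 * k + 1)) xs @ [2 * k + 1]) ` (UNIV \<times> oe_lists m)"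
      by (intro image_eqI[of _ _ "(k, xs)"]) auto
  qed (auto simp only: split: prod.splits intro!: oe_lists_append)
qed

lemma oe_lists_0: "oe_lists 0 = {[]}"
  by (auto simp: oe_lists_def odd_even_partition_of_def partition_of_def)

lemma sum_list_map_add_const: "sum_list (map (\<lambda>x. x + c) xs) = sum_list xs + length xs * (c::nat)"
  by (induction xs) auto

lemma oe_term_Suc: "oe_term q (Suc m) = oe_term q m * (q ^ Suc m / (1 - q ^ (2 * Suc m)))"
  by (simp add: oe_term_def)

lemma oe_term_0 [simp]: "oe_term q 0 = 1"
  by (simp add: oe_term_def)

text \<open>Under the bijection the size grows by \<open>(2k+1)(m+1)\<close>, and the geometric sum
  over \<open>k\<close> is the new factor of \<open>oe_term\<close>. Negative \<open>q\<close> is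
  included for the later evaluation at \<open>- q\<close>.\<close>

lemma has_sum_oe_lists:
  fixes q :: real
  assumes q: "\<bar>q\<bar> < 1"
  shows "((\<lambda>xs. q ^ sum_list xs) has_sum oe_term q m) (oe_lists m)"
  using q
proof (induction m arbitrary: q)
  case 0
  then show ?case using has_sum_finite[of "{[]}" "\<lambda>xs. q ^ sum_list xs"] by (simp add: oe_lists_0)
next
  case (Suc m)
  have geo: "((\<lambda>k. r ^ ((2 * k + 1) * Suc m)) has_sum (r ^ Suc m / (1 - r ^ (2 * Suc m)))) UNIV"
    if r: "\<bar>r\<bar> < 1" for r :: real
  proof -
    have less_1: "\<bar>r ^ (2 * Suc m)\<bar> < 1"
      unfolding power_abs using r by (subst power_less_one_iff) auto
    have "((\<lambda>k. x ^ k) has_sum (1 / (1 - x))) UNIV" if "\<bar>x\<bar> < 1" for x :: real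
      using that by (intro norm_summable_imp_has_sum geometric_sums)
        (simp_all add: power_abs summable_geometric)
    from this[OF less_1]
    have "((\<lambda>k. (r ^ (2 * Suc m)) ^ k) has_sum (1 / (1 - r ^ (2 * Suc m)))) UNIV" .
    from has_sum_cmult_right[OF this, of "r ^ Suc m"]
    have "((\<lambda>k. r ^ Suc m * (r ^ (2 * Suc m)) ^ k) has_sum (r ^ Suc m / (1 - r ^ (2 * Suc m)))) UNIV"
      by simp
    moreover have "r ^ Suc m * (r ^ (2 * Suc m)) ^ k = r ^ ((2 * k + 1) * Suc m)" for k
      unfolding power_mult [symmetric] power_add [symmetric] by (simp add: algebra_simps)
    ultimately show ?thesis by (simp only:)
  qed
  let ?f = "\<lambda>r. \<lambda>(k, xs). r ^ ((2 * k + 1) * Suc m) * r ^ sum_list xs :: real"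
  have fibre: "((\<lambda>xs. ?f r (k, xs)) has_sum (r ^ ((2 * k + 1) * Suc m) * oe_term r m)) (oe_lists m)"
    if "\<bar>r\<bar> < 1" for r :: real and k
    using has_sum_cmult_right[OF Suc.IH[OF that]] by simp
  have base: "((\<lambda>k. r ^ ((2 * k + 1) * Suc m) * oe_term r m) has_sum oe_term r (Suc m)) UNIV"
    if "\<bar>r\<bar> < 1" for r :: real
    using has_sum_cmult_left[OF geo[OF that], of "oe_term r m"] by (simp add: oe_term_Suc mult_ac)
  \<comment> \<open>At \<open>\<bar>q\<bar>\<close> all terms are nonnegative, so the iterated sums
    give summability over the product; absolute convergence carries it to \<open>q\<close>.\<close>
  have "?f \<bar>q\<bar> summable_on (UNIV \<times> oe_lists m)"
    using Suc.prems
    by (intro summable_on_SigmaI[OF fibre has_sum_imp_summable[OF base]]) auto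
  then have "?f q summable_on (UNIV \<times> oe_lists m)"
    by - (rule abs_summable_summable, simp add: case_prod_unfold abs_mult power_abs)
  then have "(?f q has_sum oe_term q (Suc m)) (UNIV \<times> oe_lists m)"
    by (intro has_sum_SigmaI[OF fibre base] Suc.prems)
  also have "?this \<longleftrightarrow> ((\<lambda>(k, xs). q ^ sum_list (map (\<lambda>x. x + (2 * k + 1)) xs @ [2 * k + 1]))
      has_sum oe_term q (Suc m)) (UNIV \<times> oe_lists m)"
  proof (intro has_sum_cong, clarify)
    fix k xs assume "xs \<in> oe_lists m"
    then have "sum_list (map (\<lambda>x. x + (2 * k + 1)) xs @ [2 * k + 1]) = (2 * k + 1) * Suc m + sum_list xs"
      unfolding sum_list_append sum_list_map_add_const by (simp add: oe_lists_def)
    then show "q ^ ((2 * k + 1) * Suc m) * q ^ sum_list xs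
        = q ^ sum_list (map (\<lambda>x. x + (2 * k + 1)) xs @ [2 * k + 1])"
      by (simp only: power_add)
  qed
  also have "\<dots> \<longleftrightarrow> ?case"
    using has_sum_reindex_bij_betw[OF bij_betw_oe_lists, of "\<lambda>xs. q ^ sum_list xs"]
    by (simp add: case_prod_unfold)
  finally show ?case .
qed

lemma oe_term_pos:
  assumes "0 < q" "q < 1"
  shows "0 < oe_term q m"
proof -
  have "q ^ (2 * j) < 1" if "0 < j" for j
    using assms that by (subst power_less_one_iff) auto
  then show ?thesis
    unfolding oe_term_def using assms by (intro prod_pos) auto
qed

lemma summable_oe_term:
  assumes "0 < q" "q < 1"
  shows "summable (oe_term q)"
proof -
  have "(\<lambda>m. q ^ Suc m / (1 - (q\<^sup>2) ^ Suc m)) \<longlonglongrightarrow> 0 / (1 - 0)"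
    using assms
    by (intro tendsto_divide tendsto_diff tendsto_const LIMSEQ_Suc LIMSEQ_power_zero)
       (auto simp: power_less_one_iff)
  then have "\<forall>\<^sub>F m in sequentially. q ^ Suc m / (1 - (q\<^sup>2) ^ Suc m) < 1 / 2"
    by (rule order_tendstoD) simp
  then obtain N where N: "q ^ Suc m / (1 - (q\<^sup>2) ^ Suc m) < 1 / 2" if "m \<ge> N" for m
    by (auto simp: eventually_sequentially)
  show ?thesis
  proof (rule summable_ratio_test)
    fix m assume "m \<ge> N"
    then have "q ^ Suc m / (1 - q ^ (2 * Suc m)) \<le> 1 / 2"
      using N[of m] by (simp only: power_mult less_imp_le)
    then have "oe_term q m * (q ^ Suc m / (1 - q ^ (2 * Suc m))) \<le> oe_term q m * (1 / 2)"
      using oe_term_pos[OF assms, of m] by (intro mult_left_mono) auto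
    then show "norm (oe_term q (Suc m)) \<le> 1 / 2 * norm (oe_term q m)"
      using oe_term_pos[OF assms, of m] oe_term_pos[OF assms, of "Suc m"]
      by (simp only: oe_term_Suc [symmetric]) simp
  qed simp
qed

text \<open>The empty list is the only partition of 0, so the convention \<open>OE 0 = 1\<close>
  agrees with the count.\<close>

lemma OE_eq_card: "OE n = card {xs. odd_even_partition_of n xs}"
proof (cases "n = 0")
  case True
  have "{xs. odd_even_partition_of 0 xs} = {[]}"
  proof -
    have "xs = []" if "odd_even_partition_of 0 xs" for xs
      using that by (cases xs) (auto simp: odd_even_partition_of_def partition_of_def)
    moreover have "odd_even_partition_of 0 []"
      by (auto simp: odd_even_partition_of_def partition_of_def)
    ultimately show ?thesis by auto
  qed
  then show ?thesis by (simp add: OE_def True)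
qed (simp add: OE_def)

lemma finite_partition_of: "finite {xs. partition_of n xs}"
proof (rule finite_subset)
  have len: "length xs \<le> sum_list xs" if "\<forall>x\<in>set xs. 0 < x" for xs :: "nat list"
    using that by (induction xs) auto
  show "{xs. partition_of n xs} \<subseteq> {xs. set xs \<subseteq> {..n} \<and> length xs \<le> n}"
    by (auto simp: partition_of_def member_le_sum_list len)
qed (simp add: finite_lists_length_le)

text \<open>Sum \<open>q ^ sum_list xs\<close> over all odd-even partitions in two ways: grouping by
  number of parts gives the series of \<open>oe_term\<close>, grouping by size that of
  \<open>OE\<close>. Absolute summability justifies the exchange.\<close>

lemma OE_sums:
  assumes "0 < \<bar>q\<bar>" "\<bar>q\<bar> < 1"
  shows "(\<lambda>n. real (OE n) * q ^ n) sums (\<Sum>m. oe_term q m)"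
proof -
  have summable: "summable (\<lambda>m. oe_term \<bar>q\<bar> m)"
    using assms by (intro summable_oe_term) auto
  have abs_le: "\<bar>oe_term q m\<bar> \<le> oe_term \<bar>q\<bar> m" for m
    unfolding oe_term_def abs_prod
  proof (intro prod_mono conjI)
    fix j assume "j \<in> {1..m}"
    then show "\<bar>q ^ j / (1 - q ^ (2 * j))\<bar> \<le> \<bar>q\<bar> ^ j / (1 - \<bar>q\<bar> ^ (2 * j))"
      using assms power_less_one_iff[of "\<bar>q\<bar>" "2 * j"] by (simp add: power_abs power_even_abs)
  qed auto
  let ?f = "\<lambda>q. \<lambda>(m, xs). q ^ sum_list xs :: real"
  let ?L = "SIGMA m:UNIV. oe_lists m"
  have "?f \<bar>q\<bar> summable_on ?L"
    using assms has_sum_oe_lists[of "\<bar>q\<bar>"]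
    by (intro summable_on_SigmaI[of _ _ _ "oe_term \<bar>q\<bar>"] norm_summable_imp_summable_on)
       (auto simp: oe_term_pos summable less_imp_le)
  then have "?f q summable_on ?L"
    by - (rule abs_summable_summable, simp add: case_prod_unfold power_abs)
  moreover have "(oe_term q has_sum (\<Sum>m. oe_term q m)) UNIV"
  proof (rule norm_summable_imp_has_sum)
    show norm_summable: "summable (\<lambda>m. norm (oe_term q m))"
      by (rule summable_comparison_test[OF _ summable]) (simp add: abs_le)
    show "oe_term q sums (\<Sum>m. oe_term q m)"
      by (rule summable_sums[OF summable_norm_cancel[OF norm_summable]])
  qed
  ultimately have "(?f q has_sum (\<Sum>m. oe_term q m)) ?L"
    using has_sum_oe_lists[OF assms(2)] by (intro has_sum_SigmaI[where g = "oe_term q"]) auto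
  also have "?this \<longleftrightarrow> ((\<lambda>(n, xs). q ^ n) has_sum (\<Sum>m. oe_term q m))
      (SIGMA n:UNIV. {xs. odd_even_partition_of n xs})"
    by (rule has_sum_reindex_bij_witness[of _ "\<lambda>(n, xs). (length xs, xs)" "\<lambda>(m, xs). (sum_list xs, xs)"])
       (auto simp: oe_lists_def odd_even_partition_of_def partition_of_def)
  finally have "((\<lambda>n. real (OE n) * q ^ n) has_sum (\<Sum>m. oe_term q m)) UNIV"
  proof (rule has_sum_SigmaD)
    fix n
    have fin: "finite {xs. odd_even_partition_of n xs}"
      by (rule finite_subset[OF _ finite_partition_of[of n]]) (auto simp: odd_even_partition_of_def)
    show "((\<lambda>xs. case (n, xs) of (n, xs) \<Rightarrow> q ^ n) has_sum real (OE n) * q ^ n)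
        {xs. odd_even_partition_of n xs}"
      using has_sum_finite[OF fin, of "\<lambda>_. q ^ n"] by (simp add: OE_eq_card)
  qed
  then show ?thesis by (rule has_sum_imp_sums)
qed

lemma OE_gf_eq:
  assumes "0 < q" "q < 1"
  shows "OE_even_gf q = ((\<Sum>m. oe_term q m) + (\<Sum>m. oe_term (- q) m)) / 2"
    and "OE_odd_gf q = ((\<Sum>m. oe_term q m) - (\<Sum>m. oe_term (- q) m)) / 2"
proof -
  let ?F = "\<lambda>q. \<Sum>m. oe_term q m"
  have s: "(\<lambda>n. real (OE n) * q ^ n) sums ?F q" "(\<lambda>n. real (OE n) * (- q) ^ n) sums ?F (- q)"
    using assms by (auto intro!: OE_sums)
  \<comment> \<open>In each block of two consecutive exponents the half sum keeps the even term and
    the half difference the odd one.\<close>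
  have even: "(\<Sum>i\<in>{n * 2..<n * 2 + 2}. (real (OE i) * q ^ i + real (OE i) * (- q) ^ i) / 2)
      = real (OE (2 * n)) * q ^ (2 * n)"
    and odd: "(\<Sum>i\<in>{n * 2..<n * 2 + 2}. (real (OE i) * q ^ i - real (OE i) * (- q) ^ i) / 2)
      = real (OE (2 * n + 1)) * q ^ (2 * n + 1)" for n
  proof -
    have "{n * 2..<n * 2 + 2} = {2 * n, 2 * n + 1}"
      by auto
    then show "(\<Sum>i\<in>{n * 2..<n * 2 + 2}. (real (OE i) * q ^ i + real (OE i) * (- q) ^ i) / 2)
      = real (OE (2 * n)) * q ^ (2 * n)"
      and "(\<Sum>i\<in>{n * 2..<n * 2 + 2}. (real (OE i) * q ^ i - real (OE i) * (- q) ^ i) / 2)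
      = real (OE (2 * n + 1)) * q ^ (2 * n + 1)"
      by (simp_all add: power_minus_even power_minus_odd)
  qed
  have "(\<lambda>n. \<Sum>i\<in>{n * 2..<n * 2 + 2}. (real (OE i) * q ^ i + real (OE i) * (- q) ^ i) / 2)
      sums ((?F q + ?F (- q)) / 2)"
    by (intro sums_group sums_divide sums_add s) auto
  then show "OE_even_gf q = (?F q + ?F (- q)) / 2"
    unfolding OE_even_gf_def even by (rule sums_unique[symmetric])
  have "(\<lambda>n. \<Sum>i\<in>{n * 2..<n * 2 + 2}. (real (OE i) * q ^ i - real (OE i) * (- q) ^ i) / 2)
      sums ((?F q - ?F (- q)) / 2)"
    by (intro sums_group sums_divide sums_diff s) auto
  then show "OE_odd_gf q = (?F q - ?F (- q)) / 2"
    unfolding OE_odd_gf_def odd by (rule sums_unique[symmetric])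
qed

section \<open>Total variation, the series at \<open>- q\<close>, the three-term recurrence and a
  comparison principle\<close>

section \<open>Recurrence and variation of the terms\<close>

text \<open>The denominators are even in \<open>q\<close>, so only the numerators contribute a sign.
  With the exponent kept as a sum, the shift by 2 adds the odd number \<open>2m + 3\<close>.\<close>

lemma oe_term_minus:
  "oe_term (- q) m = (- 1) ^ (\<Sum>j=1..m. j) * oe_term q m"
  by (simp add: oe_term_def power_sum prod.distrib [symmetric] power_minus [of q] power_mult)

lemma oe_term_recurrence:
  assumes "0 < q" "q < 1"
  shows "oe_term q (Suc m) * (1 / q ^ Suc m - q ^ Suc m) = oe_term q m"
proof -
  have "q ^ (2 * Suc m) < 1"
    using assms by (subst power_less_one_iff) auto
  then have "q ^ Suc m / (1 - q ^ (2 * Suc m)) * (1 / q ^ Suc m - q ^ Suc m) = 1"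
    using assms unfolding mult_2 power_add by (simp add: divide_simps del: power_Suc)
  then show ?thesis
    by (simp only: oe_term_Suc mult.assoc mult_1_right)
qed

text \<open>With \<open>a = oe_term q\<close>, total \<open>G\<close> and
  \<open>t = 1 / q^(m+1) - q^(m+1)\<close>, the recurrence gives
  \<open>a_(m+1) - a_m = a_(m+1) (1 - t)\<close> and bounds the sum of
  \<open>a_(m+1) (1 - t)^2\<close> by \<open>(2/q - 1 - q) G\<close>; the mean inequality passes
  from squares to absolute values.\<close>

lemma oe_term_variation:
  assumes q: "0 < q" "q < 1"
  shows "summable (\<lambda>m. \<bar>oe_term q (Suc m) - oe_term q m\<bar>)"
    and "(\<Sum>m. \<bar>oe_term q (Suc m) - oe_term q m\<bar>) \<le> sqrt (2 / q - 1 - q) * (\<Sum>m. oe_term q m)"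
proof -
  let ?a = "oe_term q" and ?\<kappa> = "2 / q - 1 - q"
  define G where "G = (\<Sum>m. ?a m)"
  define \<delta> where "\<delta> = sqrt ?\<kappa>"
  \<comment> \<open>Majorant of \<open>a_m * t\<close>: the part \<open>(q^-m - q^m) / q\<close> of
    \<open>t\<close> turns into \<open>a_(m-1) / q\<close> by the recurrence, the rest is at most
    \<open>1/q - q\<close>. At \<open>m = 0\<close> the first part vanishes, hence the default
    0.\<close>
  define f where "f m = (case m of 0 \<Rightarrow> 0 | Suc m \<Rightarrow> ?a m / q) + (1 / q - q) * ?a m" for m
  note pos = oe_term_pos[OF q]
  have "q * q < q" using q by simp
  then have "q * q < 1" "q * q < 2 - q" using q by linarith+
  then have "0 < ?\<kappa>" "q < 1 / q" using q by (auto simp: divide_simps)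
  then have \<delta>: "0 < \<delta>" "\<delta> * \<delta> = ?\<kappa>" by (auto simp: \<delta>_def)
  have a: "?a sums G"
    unfolding G_def by (intro summable_sums summable_oe_term q)
  have a1: "(\<lambda>m. ?a (Suc m)) sums (G - 1)"
    using a by (subst sums_Suc_iff) simp
  have "(\<lambda>m. case m of 0 \<Rightarrow> 0 | Suc m \<Rightarrow> ?a m / q) sums (G / q)"
    using sums_Suc_imp[of "\<lambda>m. case m of 0 \<Rightarrow> 0 | Suc m \<Rightarrow> ?a m / q"] sums_divide[OF a] by simp
  then have "f sums (G / q + (1 / q - q) * G)"
    unfolding f_def by (intro sums_add sums_mult a)
  then have g: "(\<lambda>m. \<delta> / 2 * ?a (Suc m) + (?a (Suc m) - 2 * ?a m + f m) / (2 * \<delta>)) sums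
      (\<delta> / 2 * (G - 1) + (G - 1 - 2 * G + (G / q + (1 / q - q) * G)) / (2 * \<delta>))"
    by (intro sums_add sums_mult sums_divide sums_diff a a1)
  have f: "?a m * (1 / q ^ Suc m - q ^ Suc m) \<le> f m" for m
  proof (cases m)
    case (Suc k)
    have "?a m * (1 / q ^ Suc m - q ^ Suc m)
        = ?a m * (1 / q ^ m - q ^ m) / q + (1 / q - q) * (q ^ m * ?a m)"
      using q by (simp add: field_simps)
    also have "\<dots> = ?a k / q + (1 / q - q) * (q ^ m * ?a m)"
      unfolding Suc oe_term_recurrence[OF q] ..
    also have "\<dots> \<le> ?a k / q + (1 / q - q) * (1 * ?a m)"
      using q pos[of m] \<open>q < 1 / q\<close>
      by (intro add_left_mono mult_left_mono mult_right_mono) (auto simp: power_le_one)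
    finally show ?thesis by (simp add: f_def Suc)
  qed (simp add: f_def)
  have le: "\<bar>?a (Suc m) - ?a m\<bar> \<le> \<delta> / 2 * ?a (Suc m) + (?a (Suc m) - 2 * ?a m + f m) / (2 * \<delta>)"
    for m
  proof -
    define t where "t = 1 / q ^ Suc m - q ^ Suc m"
    have t: "?a (Suc m) * t = ?a m"
      unfolding t_def by (rule oe_term_recurrence[OF q])
    \<comment> \<open>Mean inequality with weight \<open>\<delta>\<close>; the choice of
      \<open>\<delta>\<close> makes both halves contribute \<open>\<delta> * G / 2\<close> in the
      end.\<close>
    have "0 \<le> (\<delta> - \<bar>1 - t\<bar>)\<^sup>2" by simp
    then have "\<bar>1 - t\<bar> * (2 * \<delta>) \<le> \<delta> * \<delta> + (1 - t)\<^sup>2"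
      by (simp add: power2_eq_square algebra_simps abs_mult_self_eq)
    then have "\<bar>1 - t\<bar> \<le> \<delta> / 2 + (1 - t)\<^sup>2 / (2 * \<delta>)"
      using \<delta> by (simp add: field_simps)
    then have "?a (Suc m) * \<bar>1 - t\<bar> \<le> ?a (Suc m) * (\<delta> / 2 + (1 - t)\<^sup>2 / (2 * \<delta>))"
      using pos[of "Suc m"] by (intro mult_left_mono) auto
    also have "\<dots> = \<delta> / 2 * ?a (Suc m)
        + (?a (Suc m) - 2 * (?a (Suc m) * t) + ?a (Suc m) * t * t) / (2 * \<delta>)"
      by (simp add: power2_eq_square field_simps)
    also have "\<dots> \<le> \<delta> / 2 * ?a (Suc m) + (?a (Suc m) - 2 * ?a m + f m) / (2 * \<delta>)"
      unfolding t using f[of m] \<delta>(1)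
      by (intro add_left_mono divide_right_mono) (auto simp: t_def)
    also have "?a (Suc m) * \<bar>1 - t\<bar> = \<bar>?a (Suc m) * (1 - t)\<bar>"
      using pos[of "Suc m"] by (simp add: abs_mult)
    also have "?a (Suc m) * (1 - t) = ?a (Suc m) - ?a m"
      using t by (simp add: algebra_simps)
    finally show ?thesis .
  qed
  show summable: "summable (\<lambda>m. \<bar>?a (Suc m) - ?a m\<bar>)"
    by (rule summable_comparison_test[OF _ sums_summable[OF g]]) (use le in auto)
  have "(\<Sum>m. \<bar>?a (Suc m) - ?a m\<bar>)
      \<le> \<delta> / 2 * (G - 1) + (G - 1 - 2 * G + (G / q + (1 / q - q) * G)) / (2 * \<delta>)"
    by (rule sums_le[OF le summable_sums[OF summable] g])
  \<comment> \<open>The bracket is \<open>?\<kappa> * G - 1\<close>, whence the value of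
    \<open>?\<kappa>\<close>; the negative terms caused by \<open>a_0 = 1\<close> are
    dropped.\<close>
  also have "\<dots> \<le> \<delta> / 2 * G + ?\<kappa> * G / (2 * \<delta>)"
    using \<delta>(1) by (intro add_mono divide_right_mono) (auto simp: algebra_simps)
  also have "\<dots> = \<delta> * G"
    unfolding \<delta>(2) [symmetric] using \<delta>(1) by (simp add: field_simps)
  finally show "(\<Sum>m. \<bar>?a (Suc m) - ?a m\<bar>) \<le> sqrt ?\<kappa> * (\<Sum>m. ?a m)"
    by (simp add: \<delta>_def G_def)
qed

text \<open>The sign of \<open>oe_term (- q) m\<close> is reversed when \<open>m\<close> increases by 2, so the series at \<open>- q\<close>
  telescopes up to the variation of \<open>oe_term q\<close>.\<close>

lemma abs_suminf_oe_term_minus_le: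
  assumes q: "0 < q" "q < 1"
  shows "\<bar>\<Sum>m. oe_term (- q) m\<bar> \<le> 3 / 2 * sqrt (2 / q - 1 - q) * (\<Sum>m. oe_term q m)"
proof -
  let ?a = "oe_term q"
  define s :: "nat \<Rightarrow> real" where "s m = (- 1) ^ (\<Sum>j=1..m. j)" for m
  define d where "d m = \<bar>?a (Suc m) - ?a m\<bar>" for m
  define H where "H = (\<Sum>m. oe_term (- q) m)"
  note d_summable = oe_term_variation(1)[OF q, folded d_def]
  have s: "s (Suc (Suc m)) = - s m" "\<bar>s m\<bar> = 1" for m
    by (simp_all add: s_def power_add power_abs)
  have eq: "oe_term (- q) = (\<lambda>m. s m * ?a m)"
    by (simp add: fun_eq_iff oe_term_minus s_def)
  have "summable (\<lambda>m. s m * ?a m)"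
    by (rule summable_comparison_test[OF _ summable_oe_term[OF q]])
       (use oe_term_pos[OF q] in \<open>auto simp: abs_mult s less_imp_le\<close>)
  then have H: "(\<lambda>m. s m * ?a m) sums H"
    unfolding H_def eq by (rule summable_sums)
  \<comment> \<open>Adding the series shifted by two, whose signs are reversed, turns
    \<open>2 * H\<close> into a sum of differences and two boundary terms.\<close>
  then have "(\<lambda>m. s (Suc (Suc m)) * ?a (Suc (Suc m))) sums (H - s 0 * ?a 0 - s 1 * ?a 1)"
    using sums_Suc_iff[of "\<lambda>m. s m * ?a m"] sums_Suc_iff[of "\<lambda>m. s (Suc m) * ?a (Suc m)"]
    by (simp add: algebra_simps)
  from sums_add[OF H this]
  have diff: "(\<lambda>m. s m * (?a m - ?a (Suc (Suc m)))) sums (2 * H - (s 0 * ?a 0 + s 1 * ?a 1))"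
    by (simp add: s algebra_simps)
  have le: "norm (s m * (?a m - ?a (Suc (Suc m)))) \<le> d m + d (Suc m)" for m
    by (simp add: abs_mult s d_def)
  have summable2: "summable (\<lambda>m. d m + d (Suc m))"
    by (intro summable_add d_summable) (simp add: summable_Suc_iff d_summable)
  have "\<bar>2 * H - (s 0 * ?a 0 + s 1 * ?a 1)\<bar> \<le> (\<Sum>m. d m + d (Suc m))"
    using norm_sums_le[OF diff summable_sums[OF summable2] le] by simp
  also have "\<dots> = (\<Sum>m. d m) + (\<Sum>m. d (Suc m))"
    by (intro suminf_add [symmetric] d_summable) (simp add: summable_Suc_iff d_summable)
  also have "\<dots> = 2 * (\<Sum>m. d m) - d 0"
    using suminf_split_head[OF d_summable] by simp
  also have "s 0 * ?a 0 + s 1 * ?a 1 = ?a 0 - ?a 1"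
    by (simp add: s_def)
  \<comment> \<open>The boundary term \<open>?a 0 - ?a 1\<close> has absolute value
    \<open>d 0\<close>, exactly what the shifted sum of \<open>d\<close> leaves out.\<close>
  finally have "2 * \<bar>H\<bar> \<le> 2 * (\<Sum>m. d m)"
    by (simp add: d_def)
  also have "\<dots> \<le> 2 * (sqrt (2 / q - 1 - q) * (\<Sum>m. ?a m))"
    using oe_term_variation(2)[OF q] by (simp add: d_def)
  finally show ?thesis
    using oe_term_pos[OF q] by (simp add: H_def)
qed

text \<open>The factor \<open>1 - q^(2m)\<close> in the terms of \<open>G z - G (q^2 z)\<close>
  kills the constant term and cancels the last denominator; an index shift leaves
  \<open>q * z * G (q * z)\<close>. At \<open>z = q^n\<close> this is a three-term recurrence in
  \<open>n\<close>.\<close>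

lemma oe_series_recurrence:
  assumes q: "0 < q" "q < 1" and z: "0 \<le> z" "z \<le> 1"
  defines "G \<equiv> \<lambda>z. \<Sum>m. oe_term q m * z ^ m"
  shows "G z = G (q\<^sup>2 * z) + q * z * G (q * z)"
proof -
  have sums: "(\<lambda>m. oe_term q m * z ^ m) sums G z" if "0 \<le> z" "z \<le> 1" for z
    unfolding G_def
    by (intro summable_sums summable_comparison_test[OF _ summable_oe_term[OF q]])
       (use oe_term_pos[OF q] that in
         \<open>auto simp: abs_mult less_imp_le power_le_one intro!: mult_left_le exI[of _ 0]\<close>)
  have "(\<lambda>m. oe_term q m * z ^ m - oe_term q m * (q\<^sup>2 * z) ^ m) sums (G z - G (q\<^sup>2 * z))"
    using q z by (intro sums_diff sums) (auto intro!: mult_le_one simp: power_le_one)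
  then have "(\<lambda>m. oe_term q (Suc m) * z ^ Suc m - oe_term q (Suc m) * (q\<^sup>2 * z) ^ Suc m) sums
      (G z - G (q\<^sup>2 * z))"
    using sums_Suc_iff[of "\<lambda>m. oe_term q m * z ^ m - oe_term q m * (q\<^sup>2 * z) ^ m"] by simp
  also have "(\<lambda>m. oe_term q (Suc m) * z ^ Suc m - oe_term q (Suc m) * (q\<^sup>2 * z) ^ Suc m)
      = (\<lambda>m. q * z * (oe_term q m * (q * z) ^ m))"
  proof
    fix m
    have "oe_term q (Suc m) * z ^ Suc m - oe_term q (Suc m) * (q\<^sup>2 * z) ^ Suc m
        = (oe_term q (Suc m) * (1 / q ^ Suc m - q ^ Suc m)) * (q * z) ^ Suc m"
      using q by (simp add: power_mult_distrib power2_eq_square field_simps)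
    also have "\<dots> = q * z * (oe_term q m * (q * z) ^ m)"
      unfolding oe_term_recurrence[OF q] by simp
    finally show "oe_term q (Suc m) * z ^ Suc m - oe_term q (Suc m) * (q\<^sup>2 * z) ^ Suc m
        = q * z * (oe_term q m * (q * z) ^ m)" .
  qed
  finally have "(\<lambda>m. q * z * (oe_term q m * (q * z) ^ m)) sums (G z - G (q\<^sup>2 * z))" .
  moreover have "(\<lambda>m. q * z * (oe_term q m * (q * z) ^ m)) sums (q * z * G (q * z))"
    using q z by (intro sums_mult sums) (auto intro!: mult_le_one)
  ultimately have "G z - G (q\<^sup>2 * z) = q * z * G (q * z)"
    by (rule sums_unique2)
  then show ?thesis by simp
qed

text \<open>Domination by \<open>oe_term q m\<close> permits the termwise limit, where only
  \<open>m = 0\<close> survives because \<open>0 ^ 0 = 1\<close>.\<close>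

lemma oe_series_tendsto_1:
  assumes q: "0 < q" "q < 1"
  shows "(\<lambda>n. \<Sum>m. oe_term q m * (q ^ n) ^ m) \<longlonglongrightarrow> 1"
proof -
  have bound: "norm (oe_term q m * (q ^ n) ^ m) \<le> oe_term q m" for m n
    using q oe_term_pos[OF q, of m]
    by (auto simp: abs_mult power_le_one intro!: mult_left_le)
  have "(\<lambda>n. \<Sum>m. oe_term q m * (q ^ n) ^ m) \<longlonglongrightarrow> (\<Sum>m. oe_term q m * 0 ^ m)"
  proof (rule swap_uniform_limit')
    show "uniform_limit UNIV (\<lambda>k n. \<Sum>m<k. oe_term q m * (q ^ n) ^ m)
        (\<lambda>n. \<Sum>m. oe_term q m * (q ^ n) ^ m) sequentially"
      by (intro Weierstrass_m_test[OF _ summable_oe_term[OF q]] bound)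
    show "\<forall>\<^sub>F k in sequentially.
        ((\<lambda>n. \<Sum>m<k. oe_term q m * (q ^ n) ^ m) \<longlongrightarrow> (\<Sum>m<k. oe_term q m * 0 ^ m)) sequentially"
      using q by (intro always_eventually allI tendsto_intros LIMSEQ_power_zero) auto
    show "(\<lambda>k. \<Sum>m<k. oe_term q m * 0 ^ m) \<longlonglongrightarrow> (\<Sum>m. oe_term q m * 0 ^ m)"
      by (rule summable_LIMSEQ) simp
  qed auto
  then show ?thesis by simp
qed

text \<open>Both limits are 1, so \<open>(1 + d) * Y\<close> eventually dominates \<open>X\<close>.
  Nonnegative coefficients carry the domination down to index 0, which is the induction on the
  threshold \<open>N\<close>; then \<open>d\<close> tends to 0.\<close>

lemma supersolution_ge_subsolution:
  fixes X Y c :: "nat \<Rightarrow> real"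
  assumes X: "\<And>n. X n \<le> X (n + 2) + c n * X (n + 1)"
    and Y: "\<And>n. Y (n + 2) + c n * Y (n + 1) \<le> Y n"
    and c: "\<And>n. 0 \<le> c n"
    and lim: "X \<longlonglongrightarrow> 1" "Y \<longlonglongrightarrow> 1"
  shows "X 0 \<le> Y 0"
proof -
  have le: "X 0 \<le> (1 + d) * Y 0" if "0 < d" for d
  proof -
    have "(\<lambda>n. (1 + d) * Y n - X n) \<longlonglongrightarrow> (1 + d) * 1 - 1"
      by (intro tendsto_intros lim)
    then have "\<forall>\<^sub>F n in sequentially. 0 < (1 + d) * Y n - X n"
      by (rule order_tendstoD) (use that in simp)
    then have "\<forall>\<^sub>F n in sequentially. X n \<le> (1 + d) * Y n"
      by eventually_elim simp
    then obtain N where "\<forall>n\<ge>N. X n \<le> (1 + d) * Y n"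
      by (auto simp: eventually_sequentially)
    then show ?thesis
    proof (induction N)
      case (Suc N)
      have "X N \<le> X (N + 2) + c N * X (N + 1)"
        by (rule X)
      also have "\<dots> \<le> (1 + d) * Y (N + 2) + c N * ((1 + d) * Y (N + 1))"
        using Suc.prems c by (intro add_mono mult_left_mono) auto
      also have "\<dots> = (1 + d) * (Y (N + 2) + c N * Y (N + 1))"
        by (simp add: algebra_simps)
      also have "\<dots> \<le> (1 + d) * Y N"
        using that by (intro mult_left_mono Y) auto
      finally show ?case
        using Suc by (metis le_less_Suc_eq not_less_eq_eq not_le_imp_less less_imp_le)
    qed auto
  qed
  have "((\<lambda>d. (1 + d) * Y 0) \<longlongrightarrow> (1 + 0) * Y 0) (at_right 0)"
    by (intro tendsto_intros)
  then have "X 0 \<le> (1 + 0) * Y 0"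
    by (rule tendsto_lowerbound) (auto simp: eventually_at_right_less le intro: eventually_at_rightI[of 0 1])
  then show ?thesis by simp
qed

section \<open>Derivative and functional equations of the dilogarithm\<close>

section \<open>The dilogarithm at the golden ratio\<close>

definition dilog :: "real \<Rightarrow> real" where
  "dilog x = (\<Sum>n. x ^ Suc n / (real (Suc n))\<^sup>2)"

lemma summable_inverse_squares_Suc: "summable (\<lambda>n. 1 / (real (Suc n))\<^sup>2)"
  using inverse_squares_sums by (simp add: sums_iff add.commute)

lemma dilog_0 [simp]: "dilog 0 = 0"
  by (simp add: dilog_def)

lemma dilog_1: "dilog 1 = pi\<^sup>2 / 6"
  using inverse_squares_sums by (simp add: dilog_def sums_iff add.commute)

lemma continuous_on_dilog: "continuous_on {-1..1} dilog"
  unfolding dilog_def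
proof (rule uniform_limit_theorem)
  show "uniform_limit {-1..1} (\<lambda>k x. \<Sum>n<k. x ^ Suc n / (real (Suc n))\<^sup>2)
      (\<lambda>x. \<Sum>n. x ^ Suc n / (real (Suc n))\<^sup>2) sequentially"
    by (rule Weierstrass_m_test[OF _ summable_inverse_squares_Suc])
       (auto simp: norm_divide norm_power power_abs simp del: power_Suc of_nat_Suc
             intro!: divide_right_mono power_le_one)
qed (auto intro!: always_eventually continuous_intros simp del: power_Suc of_nat_Suc)

text \<open>Differentiate termwise. The point 0 is excluded because the quotient evaluates to 0
  there, whereas the derivative is 1.\<close>

lemma DERIV_dilog:
  assumes x: "\<bar>x\<bar> < 1" "x \<noteq> 0"
  shows "(dilog has_real_derivative - ln (1 - x) / x) (at x)"
proof -
  define c :: "nat \<Rightarrow> real" where "c n = 1 / (real n)\<^sup>2" for n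
  have summable: "summable (\<lambda>n. c n * y ^ n)" if "norm y < 1" for y :: real
  proof (rule summable_comparison_test[OF _ summable_geometric])
    have "\<bar>c n\<bar> \<le> 1" for n
      by (cases "n = 0") (auto simp: c_def divide_simps)
    then show "\<exists>N. \<forall>n\<ge>N. norm (c n * y ^ n) \<le> \<bar>y\<bar> ^ n"
      by (auto simp: abs_mult power_abs intro!: mult_left_le_one_le)
  qed (use that in auto)
  have dilog_eq: "dilog y = (\<Sum>n. c n * y ^ n)" if "norm y < 1" for y
    using suminf_split_head[OF summable[OF that]]
    by (simp add: dilog_def c_def)
  have "((\<lambda>y. \<Sum>n. c n * y ^ n) has_real_derivative (\<Sum>n. diffs c n * x ^ n)) (at x)"
    using x by (intro termdiffs_strong'[OF summable]) auto
  also have "(\<Sum>n. diffs c n * x ^ n) = - ln (1 - x) / x"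
  proof -
    have "(\<lambda>n. x ^ n / real n) sums - ln (1 - x)"
      using ln_series'[of "- x"] x sums_minus by fastforce
    then have "(\<lambda>n. x ^ Suc n / real (Suc n)) sums - ln (1 - x)"
      by (subst sums_Suc_iff) simp
    then have "(\<lambda>n. x ^ Suc n / real (Suc n) / x) sums (- ln (1 - x) / x)"
      by (rule sums_divide)
    moreover have "x ^ Suc n / real (Suc n) / x = diffs c n * x ^ n" for n
      using x by (simp add: diffs_def c_def power2_eq_square)
    ultimately show ?thesis
      by (simp add: sums_iff)
  qed
  finally show ?thesis
  proof (rule DERIV_cong_ev[THEN iffD1, rotated -1])
    have "\<forall>\<^sub>F y in nhds x. y \<in> {-1<..<1}"
      using x by (intro eventually_nhds_in_open) auto
    then show "\<forall>\<^sub>F y in nhds x. (\<Sum>n. c n * y ^ n) = dilog y"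
      by eventually_elim (auto simp: dilog_eq)
  qed auto
qed

text \<open>The difference of the two sides has derivative 0, as
  \<open>ln (1 - y^2) = ln (1 - y) + ln (1 + y)\<close>, and vanishes at 0.\<close>

lemma dilog_duplication:
  assumes "0 \<le> x" "x < 1"
  shows "dilog x + dilog (- x) = dilog (x\<^sup>2) / 2"
proof -
  let ?f = "\<lambda>x. dilog x + dilog (- x) - dilog (x\<^sup>2) / 2"
  have "?f x = ?f 0"
  proof (cases "x = 0")
    case False
    show ?thesis
    proof (rule DERIV_isconst2[of 0 x])
      have sq: "y\<^sup>2 \<in> {-1..1}" if "y \<in> {0..x}" for y
        using that assms power_le_one[of y 2] by (auto intro: order_trans[of _ 0])
      show "continuous_on {0..x} ?f"
        using assms sq
        by (intro continuous_intros continuous_on_compose2[OF continuous_on_dilog]) auto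
      fix y assume y: "0 < y" "y < x"
      then have "ln (1 - y\<^sup>2) = ln (1 - y) + ln (1 + y)"
        using assms ln_mult[of "1 - y" "1 + y"] by (simp add: power2_eq_square algebra_simps)
      moreover have "y\<^sup>2 < 1"
        using y assms by (simp add: power_less_one_iff)
      ultimately show "(?f has_real_derivative 0) (at y)"
        using y assms
        by (auto intro!: derivative_eq_intros DERIV_chain2[OF DERIV_dilog] simp: field_simps power2_eq_square)
    qed (use False assms in auto)
  qed simp
  then show ?thesis by simp
qed

text \<open>As for duplication; here \<open>1 - y / (1 + y) = 1 / (1 + y)\<close> makes the
  logarithms in the derivative cancel.\<close>

lemma dilog_landen:
  assumes "0 \<le> x" "x < 1"
  shows "dilog (- x) + dilog (x / (1 + x)) = - (ln (1 + x))\<^sup>2 / 2"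
proof -
  let ?f = "\<lambda>x. dilog (- x) + dilog (x / (1 + x)) + (ln (1 + x))\<^sup>2 / 2"
  have "?f x = ?f 0"
  proof (cases "x = 0")
    case False
    show ?thesis
    proof (rule DERIV_isconst2[of 0 x])
      show "continuous_on {0..x} ?f"
        using assms
        by (intro continuous_intros continuous_on_compose2[OF continuous_on_dilog]) 
           (auto simp: divide_simps)
      fix y assume y: "0 < y" "y < x"
      have "1 - y / (1 + y) = inverse (1 + y)"
        using y by (simp add: field_simps)
      then have "ln (1 - y / (1 + y)) = - ln (1 + y)"
        using y by (simp add: ln_inverse)
      moreover have "\<bar>y / (1 + y)\<bar> < 1" "y / (1 + y) \<noteq> 0"
        using y by auto
      ultimately show "(?f has_real_derivative 0) (at y)"
        using y assms
        by (auto intro!: derivative_eq_intros DERIV_chain2[OF DERIV_dilog] simp: divide_simps)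
           (simp add: algebra_simps power2_eq_square)?
    qed (use False assms in auto)
  qed simp
  then show ?thesis by simp
qed

text \<open>The derivative of \<open>?f\<close> vanishes on the open interval, and the constant is
  read off at 0 from the right, where the product of logarithms tends to 0 and
  \<open>dilog 1\<close> remains.\<close>

lemma dilog_reflection:
  assumes "0 < x" "x < 1"
  shows "dilog x + dilog (1 - x) = pi\<^sup>2 / 6 - ln x * ln (1 - x)"
proof -
  let ?f = "\<lambda>x. dilog x + dilog (1 - x) + ln x * ln (1 - x)"
  have const: "?f y = ?f x" if "y \<in> {0<..<1}" for y
  proof (rule DERIV_isconst3[of 0 1 y x ?f])
    fix z :: real assume "z \<in> {0<..<1}"
    then show "(?f has_real_derivative 0) (at z)"
      by (auto intro!: derivative_eq_intros DERIV_chain2[OF DERIV_dilog])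
  qed (use assms that in auto)
  have "((\<lambda>x. dilog x) \<longlongrightarrow> dilog 0) (at_right 0)"
    by (rule continuous_on_tendsto_compose[OF continuous_on_dilog])
       (auto intro!: tendsto_eq_intros eventually_at_rightI[of 0 1])
  moreover have "((\<lambda>x. dilog (1 - x)) \<longlongrightarrow> dilog (1 - 0)) (at_right 0)"
    by (rule continuous_on_tendsto_compose[OF continuous_on_dilog])
       (auto intro!: tendsto_eq_intros eventually_at_rightI[of 0 1])
  moreover have "((\<lambda>x::real. ln x * ln (1 - x)) \<longlongrightarrow> 0) (at_right 0)"
    by real_asymp
  ultimately have "(?f \<longlongrightarrow> dilog 0 + dilog (1 - 0) + 0) (at_right 0)"
    by (intro tendsto_add)
  moreover have "(?f \<longlongrightarrow> ?f x) (at_right 0)"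
    by (rule tendsto_eventually, rule eventually_at_rightI[of 0 1]) (use const in auto)
  ultimately have "?f x = dilog 0 + dilog (1 - 0) + 0"
    by (intro tendsto_unique[OF trivial_limit_at_right_real])
  then show ?thesis by (simp add: dilog_1)
qed

text \<open>At the inverse golden ratio \<open>u = 1 - u\<^sup>2\<close>, the three functional equations only involve the
  dilogarithms of \<open>u\<close>, \<open>- u\<close> and \<open>u\<^sup>2\<close>.\<close>

lemma dilog_golden_ratio:
  fixes u :: real
  assumes "0 < u" "u\<^sup>2 = 1 - u"
  shows "dilog (u\<^sup>2) = pi\<^sup>2 / 15 - (ln u)\<^sup>2"
proof -
  have "0 < u\<^sup>2" using assms(1) by simp
  then have "u < 1" unfolding assms(2) by simp
  have "1 + u = inverse u"
    using assms by (simp add: field_simps power2_eq_square)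
  moreover have "u / (1 + u) = u\<^sup>2"
    using assms by (simp add: \<open>1 + u = inverse u\<close> divide_inverse power2_eq_square)
  ultimately have "dilog (- u) + dilog (u\<^sup>2) = - (ln u)\<^sup>2 / 2"
    using dilog_landen[of u] assms \<open>u < 1\<close> by (simp add: ln_inverse)
  moreover have "dilog u + dilog (u\<^sup>2) = pi\<^sup>2 / 6 - 2 * (ln u)\<^sup>2"
  proof -
    have "ln (u\<^sup>2) = 2 * ln u"
      using assms(1) by (simp add: ln_realpow)
    then show ?thesis
      using dilog_reflection[of u] assms(1) \<open>u < 1\<close> unfolding assms(2) [symmetric]
      by (simp add: power2_eq_square)
  qed
  \<comment> \<open>The sum of these two relations minus the duplication formula reads
    \<open>5/2 * dilog (u^2) = pi^2/6 - 5/2 * (ln u)^2\<close>.\<close>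
  ultimately show ?thesis
    using dilog_duplication[of u] assms \<open>u < 1\<close> by simp
qed

section \<open>Taylor estimates, then the WKB function and its residual\<close>

section \<open>The approximate solution\<close>

lemma abs_exp_minus_linear_le:
  fixes y :: real
  assumes "\<bar>y\<bar> \<le> 1 / 2"
  shows "\<bar>exp y - 1 - y\<bar> \<le> y\<^sup>2"
proof -
  obtain t where t: "\<bar>t\<bar> \<le> \<bar>y\<bar>" "exp y = (\<Sum>m<2. y ^ m / fact m) + exp t / fact 2 * y ^ 2"
    using Maclaurin_exp_le[of y 2] by blast
  have "exp t \<le> exp (1 / 2)" using t assms by simp
  also have "\<dots> \<le> 2" by (rule exp_half_le2)
  finally have "exp t / 2 * y\<^sup>2 \<le> 1 * y\<^sup>2"
    by (intro mult_right_mono) auto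
  moreover have "exp y - 1 - y = exp t / 2 * y\<^sup>2"
    unfolding t(2) by (simp add: numeral_2_eq_2)
  moreover have "0 \<le> exp t / 2 * y\<^sup>2" by simp
  ultimately show ?thesis by linarith
qed

text \<open>Lagrange remainder for steps of either sign, as needed for both neighbours
  \<open>x + \<epsilon>\<close> and \<open>x - \<epsilon>\<close>.\<close>

lemma Taylor_2:
  fixes f f1 f2 :: "real \<Rightarrow> real"
  assumes "\<And>t. (f has_real_derivative f1 t) (at t)" "\<And>t. (f1 has_real_derivative f2 t) (at t)"
  obtains t where "\<bar>t - x\<bar> \<le> \<bar>h\<bar>" "f (x + h) = f x + h * f1 x + h\<^sup>2 / 2 * f2 t"
proof (cases "h = 0")
  case False
  let ?d = "\<lambda>m. [f, f1, f2] ! m"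
  have "\<exists>t. (if x + h < x then x + h < t \<and> t < x else x < t \<and> t < x + h) \<and>
      f (x + h) = (\<Sum>m<2. (?d m x / fact m) * (x + h - x) ^ m) + (?d 2 t / fact 2) * (x + h - x) ^ 2"
  proof (rule Taylor[of 2 ?d f "x - \<bar>h\<bar>" "x + \<bar>h\<bar>"])
    show "\<forall>m t. m < 2 \<and> x - \<bar>h\<bar> \<le> t \<and> t \<le> x + \<bar>h\<bar> \<longrightarrow> DERIV (?d m) t :> ?d (Suc m) t"
      using assms by (auto simp: less_2_cases_iff)
  qed (use False in auto)
  then obtain t where "if x + h < x then x + h < t \<and> t < x else x < t \<and> t < x + h"
    and t: "f (x + h) = (\<Sum>m<2. (?d m x / fact m) * (x + h - x) ^ m) + (?d 2 t / fact 2) * (x + h - x) ^ 2"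
    by blast
  then show thesis
    by (intro that[of t]) (auto simp: numeral_2_eq_2 split: if_splits)
qed (auto intro: that[of x])

lemma Taylor_3:
  fixes f f1 f2 f3 :: "real \<Rightarrow> real"
  assumes "\<And>t. (f has_real_derivative f1 t) (at t)" "\<And>t. (f1 has_real_derivative f2 t) (at t)"
    "\<And>t. (f2 has_real_derivative f3 t) (at t)"
  obtains t where "\<bar>t - x\<bar> \<le> \<bar>h\<bar>" "f (x + h) = f x + h * f1 x + h\<^sup>2 / 2 * f2 x + h ^ 3 / 6 * f3 t"
proof (cases "h = 0")
  case False
  let ?d = "\<lambda>m. [f, f1, f2, f3] ! m"
  have "\<exists>t. (if x + h < x then x + h < t \<and> t < x else x < t \<and> t < x + h) \<and>
      f (x + h) = (\<Sum>m<3. (?d m x / fact m) * (x + h - x) ^ m) + (?d 3 t / fact 3) * (x + h - x) ^ 3"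
  proof (rule Taylor[of 3 ?d f "x - \<bar>h\<bar>" "x + \<bar>h\<bar>"])
    show "\<forall>m t. m < 3 \<and> x - \<bar>h\<bar> \<le> t \<and> t \<le> x + \<bar>h\<bar> \<longrightarrow> DERIV (?d m) t :> ?d (Suc m) t"
      using assms by (auto simp: numeral_3_eq_3 less_Suc_eq)
  qed (use False in auto)
  then obtain t where "if x + h < x then x + h < t \<and> t < x else x < t \<and> t < x + h"
    and t: "f (x + h) = (\<Sum>m<3. (?d m x / fact m) * (x + h - x) ^ m) + (?d 3 t / fact 3) * (x + h - x) ^ 3"
    by blast
  then show thesis
    by (intro that[of t]) (auto simp: numeral_3_eq_3 power2_eq_square mult_ac split: if_splits)
qed (auto intro: that[of x])

text \<open>Solves \<open>e^\<sigma> = e^(-\<sigma>) + e^(-x)\<close>, the characteristic equation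
  of the recurrence with coefficient frozen at \<open>x\<close> and factor
  \<open>e^(-\<sigma>)\<close> per step.\<close>

definition wkb_angle :: "real \<Rightarrow> real" where
  "wkb_angle x = arsinh (exp (- x) / 2)"

text \<open>Closed form of the integral of \<open>t * coth t\<close> from 0 to \<open>s\<close>,
  where \<open>s\<close> is the angle and not \<open>x\<close>; the constant makes the limit at 0
  vanish.\<close>

definition wkb_phase :: "real \<Rightarrow> real" where
  "wkb_phase s = pi\<^sup>2 / 12 + s\<^sup>2 / 2 + s * ln (1 - exp (- 2 * s)) - dilog (exp (- 2 * s)) / 2"

definition wkb :: "real \<Rightarrow> real \<Rightarrow> real" where
  "wkb \<epsilon> x = exp (wkb_phase (wkb_angle x) / \<epsilon> - ln (cosh (wkb_angle x)) / 2)"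

lemma sinh_wkb_angle: "sinh (wkb_angle x) = exp (- x) / 2"
  by (simp add: wkb_angle_def)

lemma cosh_wkb_angle: "cosh (wkb_angle x) = sqrt (1 + (exp (- x) / 2)\<^sup>2)"
  by (rule real_sqrt_unique[symmetric]) (simp_all add: cosh_square_eq sinh_wkb_angle)

lemma wkb_angle_pos: "0 < wkb_angle x"
  using sinh_real_pos_iff[of "wkb_angle x"] by (simp add: sinh_wkb_angle)

lemma tanh_wkb_angle_bounds:
  "0 < tanh (wkb_angle x)" "tanh (wkb_angle x) < 1" "tanh (wkb_angle x) \<le> exp (- x) / 2"
proof -
  show "0 < tanh (wkb_angle x)" "tanh (wkb_angle x) < 1"
    by (simp_all add: wkb_angle_pos tanh_real_lt_1)
  have "tanh (wkb_angle x) \<le> sinh (wkb_angle x) / 1"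
    unfolding tanh_def using wkb_angle_pos[of x] cosh_real_ge_1 by (intro divide_left_mono) auto
  then show "tanh (wkb_angle x) \<le> exp (- x) / 2"
    by (simp add: sinh_wkb_angle)
qed

lemma DERIV_wkb_angle: "(wkb_angle has_real_derivative - tanh (wkb_angle x)) (at x)"
proof -
  have "(wkb_angle has_real_derivative 1 / sqrt ((exp (- x) / 2)\<^sup>2 + 1) * (- exp (- x) / 2)) (at x)"
    unfolding wkb_angle_def
    by (rule DERIV_chain2[OF arsinh_real_has_field_derivative]) (auto intro!: derivative_eq_intros)
  then show ?thesis
    by (simp add: tanh_def sinh_wkb_angle cosh_wkb_angle add.commute mult.commute)
qed

lemma DERIV_minus_wkb_angle: "((\<lambda>x. - wkb_angle x) has_real_derivative tanh (wkb_angle x)) (at x)"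
  using DERIV_minus[OF DERIV_wkb_angle[of x]] by simp

text \<open>In terms of \<open>E = exp (- 2 * s)\<close> the logarithms cancel, and
  \<open>(1 + E) / (1 - E)\<close> is \<open>coth s\<close>.\<close>

lemma DERIV_wkb_phase:
  assumes "0 < s"
  shows "(wkb_phase has_real_derivative s * cosh s / sinh s) (at s)"
proof -
  define E where "E = exp (- 2 * s)"
  have E: "0 < E" "E < 1" using assms by (auto simp: E_def)
  have "(wkb_phase has_real_derivative
      s + (ln (1 - E) + s * (2 * E / (1 - E))) - (- ln (1 - E) / E) * (- 2 * E) / 2) (at s)"
    unfolding wkb_phase_def E_def
    using E by (auto intro!: derivative_eq_intros DERIV_chain2[OF DERIV_dilog] simp: E_def)
  also have "s + (ln (1 - E) + s * (2 * E / (1 - E))) - (- ln (1 - E) / E) * (- 2 * E) / 2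
      = s * ((1 + E) / (1 - E))"
    using E by (simp add: field_simps)
  also have "(1 + E) / (1 - E) = cosh s / sinh s"
  proof -
    have "sinh s / cosh s = (1 - E) / (1 + E)"
      using tanh_real_altdef[of s] by (simp add: tanh_def E_def)
    then have "inverse (sinh s / cosh s) = inverse ((1 - E) / (1 + E))" by simp
    then show ?thesis by simp
  qed
  finally show ?thesis by simp
qed

lemma wkb_phase_tendsto_0: "(wkb_phase \<longlongrightarrow> 0) (at_right 0)"
proof -
  have "((\<lambda>s. dilog (exp (- 2 * s))) \<longlongrightarrow> dilog (exp (- 2 * 0))) (at_right 0)"
    by (rule continuous_on_tendsto_compose[OF continuous_on_dilog])
       (auto intro!: tendsto_eq_intros eventually_at_rightI[of 0 1] intro: order_trans[of _ 0])
  moreover have "((\<lambda>s::real. s * ln (1 - exp (- 2 * s))) \<longlongrightarrow> 0) (at_right 0)"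
    by real_asymp
  ultimately have "(wkb_phase \<longlongrightarrow> pi\<^sup>2 / 12 + 0\<^sup>2 / 2 + 0 - dilog (exp (- 2 * 0)) / 2) (at_right 0)"
    unfolding wkb_phase_def by (intro tendsto_intros) simp_all
  then show ?thesis by (simp add: dilog_1)
qed

text \<open>Here \<open>exp (- s)\<close> is the inverse golden ratio; inserting the dilogarithm
  value cancels the multiples of \<open>s^2\<close> and leaves
  \<open>pi^2/12 - pi^2/30\<close>.\<close>

lemma wkb_phase_wkb_angle_0: "wkb_phase (wkb_angle 0) = pi\<^sup>2 / 20"
proof -
  define s where "s = wkb_angle 0"
  define u where "u = exp (- s)"
  have "exp s - u = 1"
    using sinh_wkb_angle[of 0] by (simp add: s_def u_def sinh_field_def)
  then have "(exp s - u) * u = u" by simp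
  then have u: "0 < u" "u\<^sup>2 = 1 - u"
    by (simp_all add: u_def algebra_simps power2_eq_square exp_minus)
  have "exp (- 2 * s) = u\<^sup>2"
    by (simp add: u_def exp_double [symmetric])
  moreover have "ln (1 - u\<^sup>2) = - s" "ln u = - s"
    using u by (simp_all add: u_def)
  ultimately show ?thesis
    using dilog_golden_ratio[OF u] by (simp add: wkb_phase_def s_def [symmetric] power2_eq_square field_simps)
qed

lemma wkb_0: "wkb \<epsilon> 0 = sqrt (2 / sqrt 5) * exp (pi\<^sup>2 / (20 * \<epsilon>))"
proof -
  have "cosh (wkb_angle 0) = sqrt (5 / 4)"
    by (simp add: cosh_wkb_angle power2_eq_square)
  also have "\<dots> = sqrt 5 / 2"
    by (simp add: real_sqrt_divide)
  finally have "exp (- ln (cosh (wkb_angle 0)) / 2) = (sqrt 5 / 2) powr (- 1 / 2)"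
    by (simp add: powr_def)
  also have "\<dots> = sqrt (2 / sqrt 5)"
    by (simp add: powr_minus powr_half_sqrt inverse_eq_divide real_sqrt_divide)
  finally have amplitude: "exp (- ln (cosh (wkb_angle 0)) / 2) = sqrt (2 / sqrt 5)" .
  show ?thesis
    by (simp add: wkb_def wkb_phase_wkb_angle_0 exp_add [symmetric] flip: amplitude)
qed

text \<open>The angle tends to 0 from above, so phase and amplitude exponent vanish. The limit
  matches that of the series, as the comparison requires.\<close>

lemma wkb_tendsto_1: "(wkb \<epsilon> \<longlongrightarrow> 1) at_top"
proof -
  have "((\<lambda>x::real. arsinh (exp (- x) / 2)) \<longlongrightarrow> 0) at_top"
    unfolding arsinh_real_def by real_asymp
  then have lim: "(wkb_angle \<longlongrightarrow> 0) at_top"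
    by (simp add: wkb_angle_def [abs_def])
  then have "filterlim wkb_angle (at_right 0) at_top"
    by (simp add: filterlim_at wkb_angle_pos less_imp_neq[OF wkb_angle_pos, symmetric])
  from filterlim_compose[OF wkb_phase_tendsto_0 this]
  have "((\<lambda>x. wkb_phase (wkb_angle x)) \<longlongrightarrow> 0) at_top" .
  then have "(wkb \<epsilon> \<longlongrightarrow> exp (0 * inverse \<epsilon> - ln (cosh 0) / 2)) at_top"
    unfolding wkb_def divide_inverse by (intro tendsto_intros lim) auto
  then show ?thesis by simp
qed

lemma DERIV_wkb_phase_angle:
  "((\<lambda>x. wkb_phase (wkb_angle x)) has_real_derivative - wkb_angle x) (at x)"
  by (rule DERIV_cong[OF DERIV_chain2[OF DERIV_wkb_phase DERIV_wkb_angle]])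
     (use wkb_angle_pos[of x] in \<open>simp_all add: tanh_def\<close>)

lemma DERIV_tanh_wkb_angle:
  "((\<lambda>x. tanh (wkb_angle x)) has_real_derivative
     - (1 - (tanh (wkb_angle x))\<^sup>2) * tanh (wkb_angle x)) (at x)"
  by (rule DERIV_cong[OF has_field_derivative_tanh[OF cosh_real_nonzero DERIV_wkb_angle]]) (simp flip: mult_minus_left)

lemma DERIV_ln_cosh_wkb_angle:
  "((\<lambda>x. - ln (cosh (wkb_angle x)) / 2) has_real_derivative (tanh (wkb_angle x))\<^sup>2 / 2) (at x)"
  using DERIV_cdivide[OF DERIV_minus[OF DERIV_chain2[OF DERIV_ln[OF cosh_real_pos]
    has_field_derivative_cosh[OF DERIV_wkb_angle[of x]]]], of 2]
  by (rule DERIV_cong) (simp add: tanh_def power2_eq_square inverse_eq_divide)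

lemma DERIV_tanh_wkb_angle_square:
  "((\<lambda>x. (tanh (wkb_angle x))\<^sup>2 / 2) has_real_derivative
     - (1 - (tanh (wkb_angle x))\<^sup>2) * (tanh (wkb_angle x))\<^sup>2) (at x)"
  using DERIV_cdivide[OF DERIV_power[OF DERIV_tanh_wkb_angle[of x], of 2], of 2]
  by (rule DERIV_cong) (simp add: power2_eq_square)

text \<open>Expanding the exponent, the phase over \<open>\<epsilon>\<close> gives
  \<open>- \<eta> * wkb_angle x + \<epsilon> * T / 2\<close> and the amplitude gives
  \<open>\<eta> * \<epsilon> * T^2 / 2\<close>. The factor \<open>exp (- x)\<close> in the error
  makes it summable over all steps.\<close>

lemma wkb_step:
  assumes \<epsilon>: "0 < \<epsilon>" "\<epsilon> \<le> 1 / 2" and \<eta>: "\<eta> = 1 \<or> \<eta> = - 1" and x: "0 \<le> x"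
  defines "T \<equiv> tanh (wkb_angle x)"
  obtains y where "wkb \<epsilon> (x + \<eta> * \<epsilon>) = wkb \<epsilon> x * exp (- \<eta> * wkb_angle x) * exp y"
    and "\<bar>y\<bar> \<le> 1 / 2"
    and "\<bar>exp y - (1 + \<epsilon> * (T + \<eta> * T\<^sup>2) / 2)\<bar> \<le> 2 * \<epsilon>\<^sup>2 * exp (- x)"
proof -
  define h where "h = \<eta> * \<epsilon>"
  define \<kappa> where "\<kappa> = exp (- x)"
  define P where "P = (\<lambda>x. wkb_phase (wkb_angle x))"
  define a where "a = (\<lambda>x. - ln (cosh (wkb_angle x)) / 2)"
  let ?T = "\<lambda>x. tanh (wkb_angle x)"
  note T_bounds = tanh_wkb_angle_bounds
  have h: "\<bar>h\<bar> = \<epsilon>" "h \<noteq> 0" "h\<^sup>2 = \<epsilon>\<^sup>2" using \<eta> \<epsilon> by (auto simp: h_def)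
  have "T \<le> \<kappa> / 2" "0 < T" "T < 1" using T_bounds[of x] by (auto simp: T_def \<kappa>_def)
  have \<kappa>: "0 < \<kappa>" "\<kappa> \<le> 1" using x by (auto simp: \<kappa>_def)
  \<comment> \<open>A shift by at most 1/2 costs a factor \<open>exp (1/2) \<le> 2\<close>, absorbed
    by the 1/2 in the bound for \<open>tanh\<close>.\<close>
  have T_le: "?T t \<le> \<kappa>" if "\<bar>t - x\<bar> \<le> \<epsilon>" for t
  proof -
    have "?T t \<le> exp (- t) / 2" by (rule T_bounds)
    also have "\<dots> \<le> exp (1 / 2 + (- x)) / 2"
      using that \<epsilon> by simp
    also have "\<dots> \<le> 2 * exp (- x) / 2"
      unfolding exp_add using exp_half_le2 by (intro divide_right_mono mult_right_mono) auto
    finally show ?thesis by (simp add: \<kappa>_def)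
  qed

  obtain t where t: "\<bar>t - x\<bar> \<le> \<epsilon>"
    and P: "P (x + h) = P x - h * wkb_angle x + h\<^sup>2 * T / 2 - h ^ 3 / 6 * ((1 - (?T t)\<^sup>2) * ?T t)"
  proof (rule Taylor_3[OF DERIV_wkb_phase_angle DERIV_minus_wkb_angle DERIV_tanh_wkb_angle, of x h])
    fix t assume "\<bar>t - x\<bar> \<le> \<bar>h\<bar>" "wkb_phase (wkb_angle (x + h)) = wkb_phase (wkb_angle x)
        + h * - wkb_angle x + h\<^sup>2 / 2 * ?T x + h ^ 3 / 6 * (- (1 - (?T t)\<^sup>2) * ?T t)"
    then show thesis
      by (intro that[of t]) (simp_all only: P_def T_def h(1) mult_minus_left mult_minus_right
          add_uminus_conv_diff times_divide_eq_left)
  qed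
  obtain t' where t': "\<bar>t' - x\<bar> \<le> \<epsilon>"
    and a: "a (x + h) = a x + h * T\<^sup>2 / 2 - h\<^sup>2 / 2 * ((1 - (?T t')\<^sup>2) * (?T t')\<^sup>2)"
  proof (rule Taylor_2[OF DERIV_ln_cosh_wkb_angle DERIV_tanh_wkb_angle_square, of x h])
    fix t assume "\<bar>t - x\<bar> \<le> \<bar>h\<bar>" "- ln (cosh (wkb_angle (x + h))) / 2 = - ln (cosh (wkb_angle x)) / 2
        + h * ((?T x)\<^sup>2 / 2) + h\<^sup>2 / 2 * (- (1 - (?T t)\<^sup>2) * (?T t)\<^sup>2)"
    then show thesis
      by (intro that[of t]) (simp_all only: a_def T_def h(1) mult_minus_left mult_minus_right
          add_uminus_conv_diff times_divide_eq_left times_divide_eq_right)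
  qed

  define A where "A = (1 - (?T t)\<^sup>2) * ?T t"
  define B where "B = (1 - (?T t')\<^sup>2) * (?T t')\<^sup>2"
  \<comment> \<open>The two Lagrange remainders; the cubic one of the phase is divided by
    \<open>\<epsilon>\<close>, so both are of second order.\<close>
  define \<rho> where "\<rho> = - (h ^ 3 / 6 * A / \<epsilon>) - h\<^sup>2 / 2 * B"
  define y where "y = \<epsilon> * (T + \<eta> * T\<^sup>2) / 2 + \<rho>"
  have sq: "(?T z)\<^sup>2 \<le> 1" "0 \<le> (?T z)\<^sup>2" "(?T z)\<^sup>2 \<le> ?T z" for z
    using T_bounds[of z] by (auto simp: power2_eq_square mult_le_one intro: mult_left_le)
  have "0 \<le> A"
    unfolding A_def using sq[of t] T_bounds(1)[of t] by (intro mult_nonneg_nonneg) auto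
  have "A \<le> 1 * \<kappa>"
    unfolding A_def using sq[of t] T_bounds(1)[of t] T_le[OF t] by (intro mult_mono) auto
  have "0 \<le> B"
    unfolding B_def using sq[of t'] by (intro mult_nonneg_nonneg) auto
  have "B \<le> 1 * ?T t'"
    unfolding B_def using sq[of t'] by (intro mult_mono) auto
  then have "B \<le> \<kappa>"
    using T_le[OF t'] by simp
  have "\<rho> = - (\<eta> * (\<epsilon>\<^sup>2 * A / 6)) - \<epsilon>\<^sup>2 * B / 2"
    using \<eta> \<epsilon> by (auto simp: \<rho>_def h_def power2_eq_square power3_eq_cube)
  moreover have "0 \<le> \<epsilon>\<^sup>2 * A" "0 \<le> \<epsilon>\<^sup>2 * B"
    using \<open>0 \<le> A\<close> \<open>0 \<le> B\<close> by simp_all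
  moreover have "\<epsilon>\<^sup>2 * A \<le> \<epsilon>\<^sup>2 * \<kappa>" "\<epsilon>\<^sup>2 * B \<le> \<epsilon>\<^sup>2 * \<kappa>"
    using \<open>A \<le> 1 * \<kappa>\<close> \<open>B \<le> \<kappa>\<close> by (auto intro: mult_left_mono)
  ultimately have \<rho>: "\<bar>\<rho>\<bar> \<le> \<epsilon>\<^sup>2 * \<kappa>"
    using \<eta> by auto
  have "\<bar>T + \<eta> * T\<^sup>2\<bar> \<le> T + T\<^sup>2"
    using \<eta> \<open>0 < T\<close> sq[of x] by (auto simp: T_def)
  also have "\<dots> \<le> \<kappa>"
    using sq[of x] \<open>T \<le> \<kappa> / 2\<close> by (simp add: T_def)
  finally have "\<bar>\<epsilon> * (T + \<eta> * T\<^sup>2) / 2\<bar> \<le> \<epsilon> * \<kappa> / 2"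
    using \<epsilon> by (simp add: abs_mult)
  moreover have "\<epsilon>\<^sup>2 * \<kappa> \<le> \<epsilon> * \<kappa> / 2"
    using \<epsilon> \<kappa> by (simp add: power2_eq_square mult_right_mono)
  ultimately have y: "\<bar>y\<bar> \<le> \<epsilon> * \<kappa>"
    using \<rho> unfolding y_def by linarith
  also have "\<dots> \<le> 1 / 2 * 1"
    using \<epsilon> \<kappa> by (intro mult_mono) auto
  finally have y_half: "\<bar>y\<bar> \<le> 1 / 2" by simp
  have "\<bar>exp y - 1 - y\<bar> \<le> y\<^sup>2"
    by (rule abs_exp_minus_linear_le[OF y_half])
  also have "\<dots> \<le> (\<epsilon> * \<kappa>)\<^sup>2"
    using power_mono[OF y, of 2] by simp
  also have "\<dots> \<le> \<epsilon>\<^sup>2 * \<kappa>"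
    unfolding power_mult_distrib using \<kappa>
    by (intro mult_left_mono) (auto simp: power2_eq_square intro: mult_left_le)
  \<comment> \<open>One \<open>\<epsilon>^2 * \<kappa>\<close> comes from \<open>\<rho>\<close>, the
    other from linearising \<open>exp y\<close>.\<close>
  finally have approx: "\<bar>exp y - (1 + \<epsilon> * (T + \<eta> * T\<^sup>2) / 2)\<bar> \<le> 2 * \<epsilon>\<^sup>2 * \<kappa>"
    using \<rho> unfolding y_def by linarith
  have "h\<^sup>2 * T / 2 / \<epsilon> = \<epsilon> * T / 2" "h * wkb_angle x / \<epsilon> = \<eta> * wkb_angle x"
    using \<epsilon> h by (simp_all add: power2_eq_square h_def)
  then have "P (x + h) / \<epsilon> + a (x + h) = P x / \<epsilon> + a x - \<eta> * wkb_angle x + y"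
    unfolding P a y_def \<rho>_def A_def B_def by (simp add: add_divide_distrib diff_divide_distrib h_def algebra_simps)
  then have "wkb \<epsilon> (x + \<eta> * \<epsilon>) = wkb \<epsilon> x * exp (- \<eta> * wkb_angle x) * exp y"
    by (simp add: wkb_def P_def a_def h_def exp_add [symmetric])
  from that[OF this y_half] approx show ?thesis
    by (simp add: \<kappa>_def)
qed

text \<open>Order zero cancels by the equation defining the angle and order one by the choice of
  amplitude; only the second-order errors of the two neighbours remain.\<close>

lemma wkb_residual:
  assumes \<epsilon>: "0 < \<epsilon>" "\<epsilon> \<le> 1 / 2" and x: "0 \<le> x"
  shows "\<bar>wkb \<epsilon> (x + \<epsilon>) + exp (- x) * wkb \<epsilon> x - wkb \<epsilon> (x - \<epsilon>)\<bar>
    \<le> 8 * \<epsilon>\<^sup>2 * exp (- x) * wkb \<epsilon> (x - \<epsilon>)"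
proof -
  define s where "s = wkb_angle x"
  define T where "T = tanh s"
  define \<kappa> where "\<kappa> = exp (- x)"
  define W where "W = wkb \<epsilon> x"
  have pos: "0 < W" by (simp add: W_def wkb_def)
  obtain y where y: "wkb \<epsilon> (x + \<epsilon>) = W * exp (- s) * exp y"
      "\<bar>exp y - (1 + \<epsilon> * (T + T\<^sup>2) / 2)\<bar> \<le> 2 * \<epsilon>\<^sup>2 * \<kappa>"
    using wkb_step[OF \<epsilon> _ x, of 1] by (auto simp: s_def T_def \<kappa>_def W_def)
  obtain z where z: "wkb \<epsilon> (x - \<epsilon>) = W * exp s * exp z" "\<bar>z\<bar> \<le> 1 / 2"
      "\<bar>exp z - (1 + \<epsilon> * (T - T\<^sup>2) / 2)\<bar> \<le> 2 * \<epsilon>\<^sup>2 * \<kappa>"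
    using wkb_step[OF \<epsilon> _ x, of "- 1"] by (auto simp: s_def T_def \<kappa>_def W_def)
  define e where "e = exp y - (1 + \<epsilon> * (T + T\<^sup>2) / 2)"
  define f where "f = exp z - (1 + \<epsilon> * (T - T\<^sup>2) / 2)"
  have s: "0 < s" "\<kappa> = exp s - exp (- s)"
    using sinh_wkb_angle[of x] by (simp_all add: s_def wkb_angle_pos \<kappa>_def sinh_field_def)
  have "T * cosh s = sinh s" by (simp add: T_def tanh_def)
  then have T: "T * (exp s + exp (- s)) = exp s - exp (- s)"
    by (simp add: sinh_field_def cosh_field_def)
  \<comment> \<open>Both sides equal \<open>T / cosh s\<close>. This cancellation is what dictates
    the amplitude \<open>cosh powr (- 1/2)\<close>.\<close>
  have cancel: "exp (- s) * (T + T\<^sup>2) = exp s * (T - T\<^sup>2)"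
    using arg_cong[OF T, of "\<lambda>r. T * r"] by (simp add: power2_eq_square algebra_simps)
  have "exp (- s) * exp y + \<kappa> - exp s * exp z
      = exp (- s) * e - exp s * f + \<epsilon> / 2 * (exp (- s) * (T + T\<^sup>2) - exp s * (T - T\<^sup>2))"
    unfolding e_def f_def s(2) by (simp add: field_simps)
  also have "\<dots> = exp (- s) * e - exp s * f"
    unfolding cancel by simp
  finally have "\<bar>exp (- s) * exp y + \<kappa> - exp s * exp z\<bar> \<le> exp (- s) * \<bar>e\<bar> + exp s * \<bar>f\<bar>"
    using abs_triangle_ineq4[of "exp (- s) * e" "exp s * f"] by (simp add: abs_mult)
  also have "\<dots> \<le> exp s * (2 * \<epsilon>\<^sup>2 * \<kappa>) + exp s * (2 * \<epsilon>\<^sup>2 * \<kappa>)"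
    using y z s(1) by (intro add_mono mult_mono) (auto simp: e_def f_def)
  also have "\<dots> = exp s * (4 * \<epsilon>\<^sup>2 * \<kappa>) * 1"
    by (simp add: algebra_simps)
  \<comment> \<open>The factor \<open>2 * exp z \<ge> 1\<close> makes the error relative to
    \<open>wkb \<epsilon> (x - \<epsilon>)\<close> and turns 4 into 8.\<close>
  also have "\<dots> \<le> exp s * (4 * \<epsilon>\<^sup>2 * \<kappa>) * (2 * exp z)"
  proof (intro mult_left_mono)
    show "1 \<le> 2 * exp z"
      using exp_ge_add_one_self[of z] z(2) by linarith
  qed (simp add: \<kappa>_def)
  also have "\<dots> = 8 * \<epsilon>\<^sup>2 * \<kappa> * (exp s * exp z)"
    by simp
  finally have "W * \<bar>exp (- s) * exp y + \<kappa> - exp s * exp z\<bar>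
      \<le> W * (8 * \<epsilon>\<^sup>2 * \<kappa> * (exp s * exp z))"
    using pos by (intro mult_left_mono) auto
  moreover have "W * \<bar>exp (- s) * exp y + \<kappa> - exp s * exp z\<bar>
      = \<bar>wkb \<epsilon> (x + \<epsilon>) + exp (- x) * wkb \<epsilon> x - wkb \<epsilon> (x - \<epsilon>)\<bar>"
    unfolding y(1) z(1) using pos abs_mult[of W "exp (- s) * exp y + \<kappa> - exp s * exp z"]
    by (simp add: \<kappa>_def W_def algebra_simps)
  ultimately show ?thesis
    unfolding z(1) by (simp add: \<kappa>_def mult_ac)
qed

section \<open>Comparison of the series with the WKB function, and the two parity classes\<close>

section \<open>Asymptotics\<close>

text \<open>\<open>W * E\<close> is a supersolution and \<open>W / E\<close> a subsolution of the
  recurrence of \<open>G\<close>, all with limit 1; comparison at index 0 yields the bounds.\<close>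

lemma oe_series_bounds:
  assumes \<epsilon>: "0 < \<epsilon>" "\<epsilon> \<le> 1 / 5"
  shows "wkb \<epsilon> 0 * exp (- 16 * \<epsilon>) \<le> (\<Sum>m. oe_term (exp (- \<epsilon>)) m)"
    and "(\<Sum>m. oe_term (exp (- \<epsilon>)) m) \<le> wkb \<epsilon> 0 * exp (16 * \<epsilon>)"
proof -
  define q where "q = exp (- \<epsilon>)"
  define G where "G n = (\<Sum>m. oe_term q m * (q ^ n) ^ m)" for n
  define W where "W n = wkb \<epsilon> (real n * \<epsilon>)" for n
  \<comment> \<open>Dominates the product of \<open>exp (2 * r k)\<close> over
    \<open>k \<ge> n\<close>: the geometric sum of \<open>2 * r k\<close> is
    \<open>16 * \<epsilon>^2 * q^(n+1) / (1 - q)\<close>, and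
    \<open>\<epsilon> * q \<le> 1 - q\<close>.\<close>
  define E where "E n = exp (16 * \<epsilon> * q ^ n)" for n
  define r where "r n = 8 * \<epsilon>\<^sup>2 * q ^ (n + 1)" for n
  have q: "0 < q" "q < 1" using \<epsilon> by (auto simp: q_def)
  have W_pos: "0 < W n" for n by (simp add: W_def wkb_def)
  have q_power: "q ^ n = exp (- (real n * \<epsilon>))" for n
    by (simp add: q_def exp_of_nat_mult [symmetric])
  have G: "G n = G (n + 2) + q ^ (n + 1) * G (n + 1)" for n
  proof -
    have "q\<^sup>2 * q ^ n = q ^ (n + 2)" "q * q ^ n = q ^ (n + 1)"
      by (simp_all add: power2_eq_square)
    moreover have "0 \<le> q ^ n" "q ^ n \<le> 1"
      using q by (simp_all add: power_le_one)
    ultimately show ?thesis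
      using oe_series_recurrence[OF q, of "q ^ n"] by (simp only: G_def)
  qed
  have G_lim: "G \<longlonglongrightarrow> 1"
    unfolding G_def by (rule oe_series_tendsto_1[OF q])
  have residual: "\<bar>W (n + 2) + q ^ (n + 1) * W (n + 1) - W n\<bar> \<le> r n * W n" for n
  proof -
    define x where "x = real (n + 1) * \<epsilon>"
    have "real (n + 2) * \<epsilon> = x + \<epsilon>" "real n * \<epsilon> = x - \<epsilon>" "0 \<le> x"
      using \<epsilon> by (simp_all add: x_def algebra_simps)
    then show ?thesis
      using wkb_residual[of \<epsilon> x] \<epsilon>
      unfolding W_def r_def q_power by (simp only: x_def [symmetric])
  qed
  have r: "0 \<le> r n" "r n \<le> 1 / 2" for n
  proof -
    show "0 \<le> r n" using q by (simp add: r_def)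
    have "r n \<le> 8 * (1 / 5)\<^sup>2 * 1"
      unfolding r_def using \<epsilon> q by (intro mult_mono power_mono power_le_one) auto
    then show "r n \<le> 1 / 2" by (simp add: power2_eq_square)
  qed
  have E_step: "exp (2 * r n) * E (n + 1) \<le> E n" for n
  proof -
    have "1 + \<epsilon> \<le> exp \<epsilon>" by (rule exp_ge_add_one_self)
    then have "(1 + \<epsilon>) * q \<le> exp \<epsilon> * q"
      using q by (intro mult_right_mono) auto
    also have "\<dots> = 1" by (simp add: q_def exp_minus)
    finally have "\<epsilon> * q \<le> 1 - q" by (simp add: algebra_simps)
    then have "16 * \<epsilon> * q ^ n * (\<epsilon> * q) \<le> 16 * \<epsilon> * q ^ n * (1 - q)"
      using q \<epsilon> by (intro mult_left_mono) auto
    then have "2 * r n + 16 * \<epsilon> * q ^ (n + 1) \<le> 16 * \<epsilon> * q ^ n"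
      by (simp add: r_def algebra_simps power2_eq_square)
    then show ?thesis
      by (simp add: E_def exp_add [symmetric])
  qed
  have E_antimono: "E (n + 1) \<le> E n" for n
  proof -
    have "1 * E (n + 1) \<le> exp (2 * r n) * E (n + 1)"
      using r(1)[of n] by (intro mult_right_mono) (auto simp: E_def)
    with E_step[of n] show ?thesis by simp
  qed
  have E_pos: "0 < E n" for n by (simp add: E_def)
  have W_lim: "W \<longlonglongrightarrow> 1"
    unfolding W_def using \<epsilon>
    by (intro filterlim_compose[OF wkb_tendsto_1]) real_asymp
  have "(\<lambda>n. exp (16 * \<epsilon> * q ^ n)) \<longlonglongrightarrow> exp (16 * \<epsilon> * 0)"
    using q by (intro tendsto_intros LIMSEQ_power_zero) auto
  then have E_lim: "E \<longlonglongrightarrow> 1" by (simp add: E_def [abs_def])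

  have "G 0 \<le> W 0 * E 0"
  proof (rule supersolution_ge_subsolution[where c = "\<lambda>n. q ^ (n + 1)"])
    fix n
    have "E (n + 2) \<le> E (n + 1)" using E_antimono[of "n + 1"] by simp
    then have "W (n + 2) * E (n + 2) + q ^ (n + 1) * (W (n + 1) * E (n + 1))
        \<le> W (n + 2) * E (n + 1) + q ^ (n + 1) * (W (n + 1) * E (n + 1))"
      using W_pos[of "n + 2"] by simp
    also have "\<dots> = (W (n + 2) + q ^ (n + 1) * W (n + 1)) * E (n + 1)"
      by (simp add: algebra_simps)
    also have "\<dots> \<le> (exp (2 * r n) * W n) * E (n + 1)"
    proof (intro mult_right_mono)
      have "1 + r n \<le> exp (2 * r n)"
        using exp_ge_add_one_self[of "2 * r n"] r(1)[of n] by linarith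
      then have "(1 + r n) * W n \<le> exp (2 * r n) * W n"
        using W_pos[of n] by (intro mult_right_mono) auto
      then show "W (n + 2) + q ^ (n + 1) * W (n + 1) \<le> exp (2 * r n) * W n"
        using residual[of n] by (simp add: algebra_simps abs_le_iff)
    qed (simp add: E_def)
    also have "\<dots> = W n * (exp (2 * r n) * E (n + 1))" by simp
    also have "\<dots> \<le> W n * E n"
      using W_pos[of n] by (intro mult_left_mono E_step) auto
    finally show "W (n + 2) * E (n + 2) + q ^ (n + 1) * (W (n + 1) * E (n + 1)) \<le> W n * E n" .
    show "G n \<le> G (n + 2) + q ^ (n + 1) * G (n + 1)"
      by (rule eq_refl[OF G])
    show "0 \<le> q ^ (n + 1)" using q by simp
  qed (use G_lim tendsto_mult[OF W_lim E_lim] in auto)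
  then show "(\<Sum>m. oe_term (exp (- \<epsilon>)) m) \<le> wkb \<epsilon> 0 * exp (16 * \<epsilon>)"
    by (simp add: G_def W_def E_def q_def)

  have "W 0 / E 0 \<le> G 0"
  proof (rule supersolution_ge_subsolution[where c = "\<lambda>n. q ^ (n + 1)"])
    fix n
    \<comment> \<open>The product is \<open>1 + r - 2 r^2\<close>, which is at least 1 since
      \<open>0 \<le> r \<le> 1/2\<close>; the upper bound comes from
      \<open>\<epsilon> \<le> 1/5\<close>.\<close>
    have "1 \<le> (1 - r n) * (1 + 2 * r n)"
      using r[of n] mult_right_mono[of "2 * r n" 1 "r n"] by (simp add: algebra_simps)
    also have "\<dots> \<le> (1 - r n) * exp (2 * r n)"
      using r[of n] by (intro mult_left_mono exp_ge_add_one_self) auto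
    finally have "1 * E (n + 1) \<le> ((1 - r n) * exp (2 * r n)) * E (n + 1)"
      using E_pos by (intro mult_right_mono) (auto simp: less_imp_le)
    also have "\<dots> = (1 - r n) * (exp (2 * r n) * E (n + 1))" by simp
    also have "\<dots> \<le> (1 - r n) * E n"
      using r[of n] by (intro mult_left_mono E_step) auto
    finally have "1 / E n \<le> (1 - r n) / E (n + 1)"
      using E_pos[of n] E_pos[of "n + 1"] by (simp add: divide_simps mult.commute)
    then have "W n * (1 / E n) \<le> W n * ((1 - r n) / E (n + 1))"
      using W_pos[of n] by (intro mult_left_mono) auto
    then have "W n / E n \<le> (1 - r n) * W n / E (n + 1)"
      by (simp add: mult.commute)
    also have "\<dots> \<le> (W (n + 2) + q ^ (n + 1) * W (n + 1)) / E (n + 1)"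
      using residual[of n] E_pos[of "n + 1"]
      by (intro divide_right_mono) (auto simp: algebra_simps abs_le_iff)
    also have "\<dots> = W (n + 2) / E (n + 1) + q ^ (n + 1) * (W (n + 1) / E (n + 1))"
      by (simp add: add_divide_distrib)
    also have "\<dots> \<le> W (n + 2) / E (n + 2) + q ^ (n + 1) * (W (n + 1) / E (n + 1))"
      using W_pos[of "n + 2"] E_pos[of "n + 2"] E_antimono[of "n + 1"]
      by (intro add_right_mono divide_left_mono) (auto simp: E_pos)
    finally show "W n / E n \<le> W (n + 2) / E (n + 2) + q ^ (n + 1) * (W (n + 1) / E (n + 1))" .
    show "G (n + 2) + q ^ (n + 1) * G (n + 1) \<le> G n"
      by (rule eq_refl[OF G[symmetric]])
    show "0 \<le> q ^ (n + 1)" using q by simp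
  qed (use G_lim tendsto_divide[OF W_lim E_lim] in auto)
  then show "wkb \<epsilon> 0 * exp (- 16 * \<epsilon>) \<le> (\<Sum>m. oe_term (exp (- \<epsilon>)) m)"
    by (simp add: G_def W_def E_def q_def exp_minus divide_inverse)
qed

lemma oe_series_asymp_wkb:
  "((\<lambda>\<epsilon>. (\<Sum>m. oe_term (exp (- \<epsilon>)) m) / wkb \<epsilon> 0) \<longlongrightarrow> 1) (at_right 0)"
proof (rule tendsto_sandwich)
  have pos: "0 < wkb \<epsilon> 0" for \<epsilon> by (simp add: wkb_def)
  show "\<forall>\<^sub>F \<epsilon> in at_right 0. exp (- 16 * \<epsilon>) \<le> (\<Sum>m. oe_term (exp (- \<epsilon>)) m) / wkb \<epsilon> 0"
    using oe_series_bounds(1) pos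
    by (intro eventually_at_rightI[of 0 "1 / 5"]) (auto simp: field_simps)
  show "\<forall>\<^sub>F \<epsilon> in at_right 0. (\<Sum>m. oe_term (exp (- \<epsilon>)) m) / wkb \<epsilon> 0 \<le> exp (16 * \<epsilon>)"
    using oe_series_bounds(2) pos
    by (intro eventually_at_rightI[of 0 "1 / 5"]) (auto simp: field_simps)
qed real_asymp+

text \<open>The factor \<open>sqrt (2/q - 1 - q)\<close> from the variation bound tends to 0 as
  \<open>q\<close> tends to 1.\<close>

lemma oe_series_minus_negligible:
  "((\<lambda>\<epsilon>. (\<Sum>m. oe_term (- exp (- \<epsilon>)) m) / (\<Sum>m. oe_term (exp (- \<epsilon>)) m)) \<longlongrightarrow> 0) (at_right 0)"
proof (rule Lim_null_comparison)
  show "((\<lambda>\<epsilon>::real. 3 / 2 * sqrt (2 / exp (- \<epsilon>) - 1 - exp (- \<epsilon>))) \<longlongrightarrow> 0) (at_right 0)"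
    by (auto intro!: tendsto_eq_intros)
  show "\<forall>\<^sub>F \<epsilon> in at_right 0. norm ((\<Sum>m. oe_term (- exp (- \<epsilon>)) m) / (\<Sum>m. oe_term (exp (- \<epsilon>)) m))
      \<le> 3 / 2 * sqrt (2 / exp (- \<epsilon>) - 1 - exp (- \<epsilon>))"
  proof (rule eventually_at_rightI[of 0 1])
    fix \<epsilon> :: real assume "\<epsilon> \<in> {0<..<1}"
    then have q: "0 < exp (- \<epsilon>)" "exp (- \<epsilon>) < 1" by auto
    have "0 < (\<Sum>m. oe_term (exp (- \<epsilon>)) m)"
      by (intro suminf_pos summable_oe_term oe_term_pos q)
    then show "norm ((\<Sum>m. oe_term (- exp (- \<epsilon>)) m) / (\<Sum>m. oe_term (exp (- \<epsilon>)) m))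
        \<le> 3 / 2 * sqrt (2 / exp (- \<epsilon>) - 1 - exp (- \<epsilon>))"
      using abs_suminf_oe_term_minus_le[OF q] by (simp add: abs_divide divide_le_eq)
  qed simp
qed

theorem theorem3p2:
  shows "(\<lambda>\<epsilon>. OE_even_gf (exp (- \<epsilon>))) \<sim>[at_right 0] (\<lambda>\<epsilon>. OE_odd_gf (exp (- \<epsilon>))) \<and>
         (\<lambda>\<epsilon>. OE_odd_gf (exp (- \<epsilon>))) \<sim>[at_right 0]
           (\<lambda>\<epsilon>. 1 / sqrt (2 * sqrt 5) * exp (pi\<^sup>2 / (20 * \<epsilon>)))"
proof -
  let ?F = "\<lambda>\<epsilon>. \<Sum>m. oe_term (exp (- \<epsilon>)) m" and ?H = "\<lambda>\<epsilon>. \<Sum>m. oe_term (- exp (- \<epsilon>)) m"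
  let ?W = "\<lambda>\<epsilon>. wkb \<epsilon> 0 / 2"
  have W_pos: "0 < wkb \<epsilon> 0" for \<epsilon> by (simp add: wkb_def)
  have F_pos: "\<forall>\<^sub>F \<epsilon> in at_right 0. 0 < ?F \<epsilon>"
    by (rule eventually_at_rightI[of 0 1]) (auto intro!: suminf_pos summable_oe_term oe_term_pos)
  have gf: "\<forall>\<^sub>F \<epsilon> in at_right 0. OE_even_gf (exp (- \<epsilon>)) = (?F \<epsilon> + ?H \<epsilon>) / 2 \<and>
      OE_odd_gf (exp (- \<epsilon>)) = (?F \<epsilon> - ?H \<epsilon>) / 2"
    by (rule eventually_at_rightI[of 0 1]) (auto simp: OE_gf_eq)
  have ratio: "f / w * (1 + h / f) = (f + h) / 2 / (w / 2)" "f / w * (1 - h / f) = (f - h) / 2 / (w / 2)"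
    if "0 < f" for f h w :: real
    using that by (simp_all add: distrib_left right_diff_distrib add_divide_distrib diff_divide_distrib)
  have even: "(\<lambda>\<epsilon>. OE_even_gf (exp (- \<epsilon>))) \<sim>[at_right 0] ?W"
  proof (rule asymp_equivI')
    have "((\<lambda>\<epsilon>. ?F \<epsilon> / wkb \<epsilon> 0 * (1 + ?H \<epsilon> / ?F \<epsilon>)) \<longlongrightarrow> 1 * (1 + 0)) (at_right 0)"
      by (intro tendsto_intros oe_series_asymp_wkb oe_series_minus_negligible)
    moreover have "\<forall>\<^sub>F \<epsilon> in at_right 0.
        ?F \<epsilon> / wkb \<epsilon> 0 * (1 + ?H \<epsilon> / ?F \<epsilon>) = OE_even_gf (exp (- \<epsilon>)) / ?W \<epsilon>"
      using F_pos gf by eventually_elim (simp only: ratio)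
    ultimately have "((\<lambda>\<epsilon>. OE_even_gf (exp (- \<epsilon>)) / ?W \<epsilon>) \<longlongrightarrow> 1 * (1 + 0)) (at_right 0)"
      by (rule Lim_transform_eventually)
    then show "((\<lambda>\<epsilon>. OE_even_gf (exp (- \<epsilon>)) / ?W \<epsilon>) \<longlongrightarrow> 1) (at_right 0)"
      by simp
  qed
  have odd: "(\<lambda>\<epsilon>. OE_odd_gf (exp (- \<epsilon>))) \<sim>[at_right 0] ?W"
  proof (rule asymp_equivI')
    have "((\<lambda>\<epsilon>. ?F \<epsilon> / wkb \<epsilon> 0 * (1 - ?H \<epsilon> / ?F \<epsilon>)) \<longlongrightarrow> 1 * (1 - 0)) (at_right 0)"
      by (intro tendsto_intros oe_series_asymp_wkb oe_series_minus_negligible)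
    moreover have "\<forall>\<^sub>F \<epsilon> in at_right 0.
        ?F \<epsilon> / wkb \<epsilon> 0 * (1 - ?H \<epsilon> / ?F \<epsilon>) = OE_odd_gf (exp (- \<epsilon>)) / ?W \<epsilon>"
      using F_pos gf by eventually_elim (simp only: ratio)
    ultimately have "((\<lambda>\<epsilon>. OE_odd_gf (exp (- \<epsilon>)) / ?W \<epsilon>) \<longlongrightarrow> 1 * (1 - 0)) (at_right 0)"
      by (rule Lim_transform_eventually)
    then show "((\<lambda>\<epsilon>. OE_odd_gf (exp (- \<epsilon>)) / ?W \<epsilon>) \<longlongrightarrow> 1) (at_right 0)"
      by simp
  qed
  \<comment> \<open>Each parity class takes half of the amplitude of the full series.\<close>
  have "sqrt (2 / sqrt 5) / 2 = sqrt (2 / sqrt 5 / 4)"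
    unfolding real_sqrt_divide [of _ 4] by simp
  also have "\<dots> = 1 / sqrt (2 * sqrt 5)"
    by (simp add: real_sqrt_divide real_sqrt_mult)
  finally have "?W = (\<lambda>\<epsilon>. 1 / sqrt (2 * sqrt 5) * exp (pi\<^sup>2 / (20 * \<epsilon>)))"
    by (simp add: wkb_0 fun_eq_iff)
  with even odd show ?thesis
    using asymp_equiv_trans asymp_equiv_symI by metis
qed

end
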